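(* Let $G$ be a Hausdorff topological gyrogroup with an $\omega^{\omega}$-base. Then the following conditions are equivalent: (1) $G$ is a $k$-space; (2) $G$ is sequential; (3) $G$ is metrizable or $G$ contains an open submetrizable $k_{\omega}$-subgyrogroup.
   Context: A gyrogroup is a nonempty set $G$ with a binary operation $\oplus$ such that: (G1) there is a unique identity element $0\in G$ with $0\oplus a=a=a\oplus 0$ for all $a\in G$; (G2) for each $x\in G$ there is a unique inverse $\ominus x\in G$ with $\ominus x\oplus x=0=x\oplus(\ominus x)$; (G3) for all $x,y\in G$ there is an automorphism $\mathrm{gyr}[x,y]$ of $(G,\oplus)$ with $x\oplus(y\oplus z)=(x\oplus y)\oplus \mathrm{gyr}[x,y](z)$ for all $z\in G$; (G4) $\mathrm{gyr}[x\oplus y,y]=\mathrm{gyr}[x,y]$ for all $x,y\in G$. A topological gyrogroup is a gyrogroup with a topology such that $\oplus:G\times G\to G$ is jointly continuous and $x\mapsto\ominus x$ is continuous. A subgyrogroup of $G$ is a nonempty subset $H\subseteq G$ that forms a gyrogroup under the operation inherited from $G$ and such that the restriction of $\mathrm{gyr}[a,b]$ to $H$ is an automorphism of $H$ for all $a,b\in H$. $\mathbb{N}^{\mathbb{N}}$ is the set of all functions $\mathbb{N}\to\mathbb{N}$ with the partial order $f\le g$ iff $f(n)\le g(n)$ for all $n$. A space $X$ has an $\omega^{\omega}$-base if every point $x\in X$ has a base of neighborhoods of the form $\{U_\alpha(x):\alpha\in\mathbb{N}^{\mathbb{N}}\}$ with $U_\beta(x)\subset U_\alpha(x)$ whenever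 $\alpha\le\beta$. A space $X$ is a $k$-space if a subset $A\subseteq X$ is closed whenever $A\cap K$ is closed in $K$ for every compact $K\subseteq X$. $X$ is sequential if for each non-closed $A\subseteq X$ there are a point $x\in X\setminus A$ and a sequence in $A$ converging to $x$. $X$ is a $k_\omega$-space if $X=\bigcup_n K_n$ for a sequence of compact sets $K_n$ such that a set $A\subseteq X$ is closed whenever every $A\cap K_n$ is closed in $K_n$. $X$ is submetrizable if it admits a coarser metrizable topology. A submetrizable $k_\omega$-subgyrogroup is a subgyrogroup which, in the subspace topology, is a submetrizable $k_\omega$-space. All topological spaces are assumed to be Hausdorff. *)

theory Defs
  imports "HOL-Analysis.Analysis"
begin

definition gyro_automorphism :: "'a set \<Rightarrow> ('a \<Rightarrow> 'a \<Rightarrow> 'a) \<Rightarrow> ('a \<Rightarrow> 'a) \<Rightarrow> bool" where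
  "gyro_automorphism G oplus f \<longleftrightarrow>
     bij_betw f G G \<and> (\<forall>x\<in>G. \<forall>y\<in>G. f (oplus x y) = oplus (f x) (f y))"

text \<open>
  The identity, the inverse and the gyrations are parameters; the axioms determine them
  uniquely on the carrier. Equality of two gyrations in \<open>loop_property\<close> means equality as
  maps on \<open>G\<close>.
\<close>

locale gyrogroup =
  fixes G :: "'a set"
    and oplus :: "'a \<Rightarrow> 'a \<Rightarrow> 'a" (infixl \<open>\<oplus>\<close> 65)
    and zero :: 'a (\<open>\<zero>\<close>)
    and neg :: "'a \<Rightarrow> 'a" (\<open>\<ominus> _\<close> [81] 80)
    and gyr :: "'a \<Rightarrow> 'a \<Rightarrow> 'a \<Rightarrow> 'a"
  assumes oplus_closed: "\<lbrakk>x \<in> G; y \<in> G\<rbrakk> \<Longrightarrow> x \<oplus> y \<in> G"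
    and zero_closed: "\<zero> \<in> G"
    and identity: "a \<in> G \<Longrightarrow> \<zero> \<oplus> a = a \<and> a \<oplus> \<zero> = a"
    and identity_unique: "\<lbrakk>e \<in> G; \<forall>a\<in>G. e \<oplus> a = a \<and> a \<oplus> e = a\<rbrakk> \<Longrightarrow> e = \<zero>"
    and neg_closed: "x \<in> G \<Longrightarrow> \<ominus> x \<in> G"
    and inverse: "x \<in> G \<Longrightarrow> \<ominus> x \<oplus> x = \<zero> \<and> x \<oplus> \<ominus> x = \<zero>"
    and inverse_unique: "\<lbrakk>x \<in> G; y \<in> G; y \<oplus> x = \<zero>; x \<oplus> y = \<zero>\<rbrakk> \<Longrightarrow> y = \<ominus> x"
    and gyr_automorphism: "\<lbrakk>x \<in> G; y \<in> G\<rbrakk> \<Longrightarrow> gyro_automorphism G (\<oplus>) (gyr x y)"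
    and gyro_assoc: "\<lbrakk>x \<in> G; y \<in> G; z \<in> G\<rbrakk> \<Longrightarrow> x \<oplus> (y \<oplus> z) = (x \<oplus> y) \<oplus> gyr x y z"
    and loop_property: "\<lbrakk>x \<in> G; y \<in> G; z \<in> G\<rbrakk> \<Longrightarrow> gyr (x \<oplus> y) y z = gyr x y z"

locale topological_gyrogroup =
  gyrogroup "topspace X" oplus zero neg gyr
  for X :: "'a topology"
    and oplus :: "'a \<Rightarrow> 'a \<Rightarrow> 'a" (infixl \<open>\<oplus>\<close> 65)
    and zero :: 'a (\<open>\<zero>\<close>)
    and neg :: "'a \<Rightarrow> 'a" (\<open>\<ominus> _\<close> [81] 80)
    and gyr :: "'a \<Rightarrow> 'a \<Rightarrow> 'a \<Rightarrow> 'a" +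
  assumes continuous_oplus: "continuous_map (prod_topology X X) X (\<lambda>(x, y). x \<oplus> y)"
    and continuous_neg: "continuous_map X X (\<lambda>x. \<ominus> x)"

definition subgyrogroup ::
  "'a set \<Rightarrow> ('a \<Rightarrow> 'a \<Rightarrow> 'a) \<Rightarrow> ('a \<Rightarrow> 'a \<Rightarrow> 'a \<Rightarrow> 'a) \<Rightarrow> 'a set \<Rightarrow> bool" where
  "subgyrogroup G oplus gyr H \<longleftrightarrow>
     H \<noteq> {} \<and> H \<subseteq> G \<and>
     (\<exists>zero' neg' gyr'. gyrogroup H oplus zero' neg' gyr') \<and>
     (\<forall>a\<in>H. \<forall>b\<in>H. gyro_automorphism H oplus (gyr a b))"

text \<open>
  Neighbourhoods need not be open. The order on \<^typ>\<open>nat \<Rightarrow> nat\<close> is the pointwise one.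
\<close>

definition has_omega_omega_base :: "'a topology \<Rightarrow> bool" where
  "has_omega_omega_base X \<longleftrightarrow>
     (\<forall>x\<in>topspace X. \<exists>U :: (nat \<Rightarrow> nat) \<Rightarrow> 'a set.
        (\<forall>\<alpha>. U \<alpha> \<subseteq> topspace X \<and> (\<exists>V. openin X V \<and> x \<in> V \<and> V \<subseteq> U \<alpha>)) \<and>
        (\<forall>W. openin X W \<and> x \<in> W \<longrightarrow> (\<exists>\<alpha>. U \<alpha> \<subseteq> W)) \<and>
        (\<forall>\<alpha> \<beta>. \<alpha> \<le> \<beta> \<longrightarrow> U \<beta> \<subseteq> U \<alpha>))"

definition sequential_space :: "'a topology \<Rightarrow> bool" where
  "sequential_space X \<longleftrightarrow>
     (\<forall>A. A \<subseteq> topspace X \<and> \<not> closedin X A \<longrightarrow>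
        (\<exists>x \<in> topspace X - A. \<exists>s :: nat \<Rightarrow> 'a. range s \<subseteq> A \<and> limitin X s x sequentially))"

definition k_omega_space :: "'a topology \<Rightarrow> bool" where
  "k_omega_space X \<longleftrightarrow>
     (\<exists>K :: nat \<Rightarrow> 'a set.
        (\<forall>n. compactin X (K n)) \<and> topspace X = (\<Union>n. K n) \<and>
        (\<forall>A. A \<subseteq> topspace X \<and> (\<forall>n. closedin (subtopology X (K n)) (A \<inter> K n))
           \<longrightarrow> closedin X A))"

definition submetrizable_space :: "'a topology \<Rightarrow> bool" where
  "submetrizable_space X \<longleftrightarrow>
     (\<exists>Y. topspace Y = topspace X \<and> (\<forall>U. openin Y U \<longrightarrow> openin X U) \<and> metrizable_space Y)"

end

theory Submission
  imports Defs "HOL-Library.Diagonal_Subsequence"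
begin

text \<open>
  Let \<open>U \<alpha>\<close> be a closed \<open>\<omega>\<^sup>\<omega>\<close>-base at the identity and \<open>D s\<close> the intersection of all \<open>U \<beta>\<close> such
  that \<open>\<beta>\<close> extends the finite sequence \<open>s\<close>. The countable family of the \<open>D s\<close> catches sequences
  converging to \<open>\<zero>\<close>. It gives countable networks for compact sets, so these are metrizable, and a
  \<open>k\<close>-space is sequential.

  For a sequential \<open>G\<close> there are two cases. If each sequence converging to \<open>\<zero>\<close> is eventually in a
  compact finite intersection of sets \<open>D s\<close>, then these compact sets generate an open
  \<open>k\<^sub>\<omega>\<close>-subgyrogroup. Otherwise there are non-compact closed sets \<open>E n\<close> shrinking to \<open>\<zero>\<close>. Adding
  sequences without convergent subsequences in \<open>E n\<close> to the rows of a double sequence converging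
  to \<open>\<zero>\<close> shows that some diagonal sequence converges to \<open>\<zero>\<close> as well. This makes \<open>G\<close>
  Frechet-Urysohn and then forces some of the \<open>D s\<close> to be neighbourhoods of \<open>\<zero>\<close>, so that \<open>G\<close> is
  first countable. Solving \<open>y \<oplus> v = p\<close> continuously for \<open>y\<close> gives the condition of Frink's
  metrization theorem.
\<close>

section \<open>Metrization\<close>

text \<open>The sets \<open>D s\<close> are countable in number but need not be neighbourhoods of
  \<open>\<zero>\<close>; if enough of them were, first countability would be immediate. The
  non-compact case therefore has to produce neighbourhoods out of sequences. The divergent terms
  added to a row act as labels: they keep a single row from producing new limits, and they fade out
  along sequences that cross the rows. Sequentiality gives a crossing sequence with some limit
  \<open>q\<close>, not yet \<open>\<zero>\<close>; trimming the rows beforehand against countably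
  many \<open>U \<alpha>\<close> pins \<open>q\<close> down. The second obstacle is the lack of
  associativity. Gyrations are not assumed to preserve small neighbourhoods of
  \<open>\<zero>\<close>, so the relations \<open>\<ominus> x \<oplus> y \<in> V\<close> are not
  known to form a uniformity, and the left-invariant metric familiar from first countable groups is
  not at hand. Frink's condition is pointwise: its index \<open>m\<close> may depend on
  \<open>x\<close>, which is what joint continuity can provide. Division on the right is no right
  translation by an inverse either; the loop property yields a formula for it.\<close>

lemma quasi_metric_chain:
  fixes f :: "'a \<Rightarrow> 'a \<Rightarrow> real"
  assumes refl: "\<And>x. x \<in> M \<Longrightarrow> f x x = 0"
    and nonneg: "\<And>x y. 0 \<le> f x y"
    and quasi: "\<And>x y z w e. \<lbrakk>x \<in> M; y \<in> M; z \<in> M; w \<in> M; f x y \<le> e; f y z \<le> e; f z w \<le> e\<rbrakk>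
                  \<Longrightarrow> f x w \<le> 2 * e"
    and p: "\<And>i. p i \<in> M"
  shows "f (p m) (p (m + k)) \<le> 2 * (\<Sum>i=m..<m+k. f (p i) (p (Suc i)))"
proof (induction k arbitrary: m rule: less_induct)
  case (less k)
  show ?case
  proof (cases "k = 0")
    case True
    then show ?thesis by (simp add: refl p)
  next
    case False
    define S where "S a b = (\<Sum>i=a..<b. f (p i) (p (Suc i)))" for a b
    define a where "a = S m (m+k)"
    have S_split: "S x z = S x y + S y z" if "x \<le> y" "y \<le> z" for x y z
      unfolding S_def using that by (simp add: sum.atLeastLessThan_concat)
    have S_nonneg: "0 \<le> S x y" for x y
      unfolding S_def by (intro sum_nonneg nonneg)
    \<comment> \<open>The chain is cut at the last vertex \<open>m+j\<close> whose initial part has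
      at most half of the total length \<open>a\<close>. What follows the next edge is then also at
      most \<open>a/2\<close>, so by induction both outer pieces and the middle edge have
      \<open>f\<close> at most \<open>a\<close>, and \<open>quasi\<close> joins the three.\<close>
    define J where "J = {j. j < k \<and> S m (m+j) \<le> a / 2}"
    have "0 \<in> J" "finite J" using False S_nonneg[of m "m+k"] by (auto simp: J_def S_def a_def)
    define j where "j = Max J"
    have "j \<in> J" unfolding j_def using \<open>0 \<in> J\<close> \<open>finite J\<close> by (intro Max_in) auto
    then have j: "j < k" "S m (m+j) \<le> a/2" by (auto simp: J_def)
    have tail: "S (m+j+1) (m+k) \<le> a/2"
    proof (cases "j + 1 = k")
      case True
      then have "S (m+j+1) (m+k) = 0" by (simp add: S_def add.assoc)
      then show ?thesis using S_nonneg[of m "m+k"] by (simp add: a_def)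
    next
      case F: False
      have "j + 1 \<notin> J" using \<open>finite J\<close> Max_ge[of J "j+1"] unfolding j_def[symmetric] by auto
      then have "S m (m+j+1) > a/2" using F j by (auto simp: J_def)
      moreover have "a = S m (m+j+1) + S (m+j+1) (m+k)"
        unfolding a_def using j by (intro S_split) auto
      ultimately show ?thesis by linarith
    qed
    have 1: "f (p m) (p (m+j)) \<le> a" using less.IH[OF j(1), of m] j(2) by (simp add: S_def)
    have "k - j - 1 < k" using j by simp
    from less.IH[OF this, of "m+j+1"] have "f (p (m+j+1)) (p (m+k)) \<le> 2 * S (m+j+1) (m+k)"
      using j by (simp add: S_def)
    with tail have 3: "f (p (m+j+1)) (p (m+k)) \<le> a" by linarith
    have "a = S m (m+j) + S (m+j) (m+j+1) + S (m+j+1) (m+k)"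
      unfolding a_def using j S_split[of m "m+j" "m+k"] S_split[of "m+j" "m+j+1" "m+k"] by simp
    moreover have "S (m+j) (m+j+1) = f (p (m+j)) (p (m+j+1))" by (simp add: S_def)
    ultimately have 2: "f (p (m+j)) (p (m+j+1)) \<le> a" 
      using S_nonneg[of m "m+j"] S_nonneg[of "m+j+1" "m+k"] by linarith
    show ?thesis using quasi[OF p p p p 1 2 3] by (simp add: a_def S_def)
  qed
qed

text \<open>The metric is the infimum of the lengths of chains. Reversing and concatenating chains
  gives symmetry and the triangle inequality; a chain with one edge gives the upper bound, and
  \<open>quasi_metric_chain\<close> the lower one.\<close>

lemma quasi_metric_imp_metric:
  fixes f :: "'a \<Rightarrow> 'a \<Rightarrow> real"
  assumes refl: "\<And>x. x \<in> M \<Longrightarrow> f x x = 0"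
    and nonneg: "\<And>x y. 0 \<le> f x y"
    and sym: "\<And>x y. f x y = f y x"
    and sep: "\<And>x y. \<lbrakk>x \<in> M; y \<in> M; f x y = 0\<rbrakk> \<Longrightarrow> x = y"
    and quasi: "\<And>x y z w e. \<lbrakk>x \<in> M; y \<in> M; z \<in> M; w \<in> M; f x y \<le> e; f y z \<le> e; f z w \<le> e\<rbrakk>
                  \<Longrightarrow> f x w \<le> 2 * e"
  obtains d where "Metric_space M d"
    "\<And>x y. \<lbrakk>x \<in> M; y \<in> M\<rbrakk> \<Longrightarrow> d x y \<le> f x y"
    "\<And>x y. \<lbrakk>x \<in> M; y \<in> M\<rbrakk> \<Longrightarrow> f x y \<le> 2 * d x y"
proof -
  define L where "L p k = (\<Sum>i<k. f (p i) (p (Suc i)))" for p :: "nat \<Rightarrow> 'a" and k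
  define C where "C x y = {L p k | p k. (\<forall>i. p i \<in> M) \<and> p 0 = x \<and> p k = y}" for x y
  \<comment> \<open>\<open>Metric_space\<close> asks for nonnegativity and symmetry at all points,
    hence the value 0 outside \<open>M\<close>.\<close>
  define d where "d x y = (if x \<in> M \<and> y \<in> M then Inf (C x y) else 0)" for x y
  have L_nonneg: "0 \<le> L p k" for p k
    unfolding L_def by (intro sum_nonneg nonneg)
  have bdd: "bdd_below (C x y)" for x y
    by (rule bdd_belowI[of _ 0]) (auto simp: C_def L_nonneg)
  have f_in: "f x y \<in> C x y" if "x \<in> M" "y \<in> M" for x y
  proof -
    have "f x y = L (\<lambda>i. if i = 0 then x else y) 1" by (simp add: L_def)
    then show ?thesis using that
      by (auto simp: C_def intro!: exI[of _ "\<lambda>i::nat. if i = 0 then x else y"] exI[of _ "1::nat"])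
  qed
  have lower: "f x y \<le> 2 * c" if h: "c \<in> C x y" for x y c
  proof -
    obtain p k where p: "\<forall>i. p i \<in> M" "p 0 = x" "p k = y" "c = L p k"
      using h unfolding C_def by blast
    show ?thesis using quasi_metric_chain[of M f p 0 k, OF refl nonneg quasi] p
      by (simp add: L_def lessThan_atLeast0)
  qed
  have C_sym: "C x y \<subseteq> C y x" for x y
  proof
    fix c assume "c \<in> C x y"
    then obtain p k where p: "\<forall>i. p i \<in> M" "p 0 = x" "p k = y" "c = L p k"
      unfolding C_def by blast
    define q where "q i = p (k - i)" for i
    have "L q k = (\<Sum>i<k. f (p (Suc (k - Suc i))) (p (k - Suc i)))"
      unfolding L_def q_def by (intro sum.cong) (auto simp: Suc_diff_Suc)
    also have "\<dots> = (\<Sum>i<k. f (p (Suc i)) (p i))"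
      by (rule sum.nat_diff_reindex)
    finally have "L q k = L p k" using sym by (simp add: L_def)
    then show "c \<in> C y x"
      using p by (auto simp: C_def q_def intro!: exI[of _ q] exI[of _ k])
  qed
  have C_concat: "c + c' \<in> C x z" if cc: "c \<in> C x y" "c' \<in> C y z" for x y z c c'
  proof -
    obtain p k where p: "\<forall>i. p i \<in> M" "p 0 = x" "p k = y" "c = L p k"
      using cc unfolding C_def by blast
    obtain q l where q: "\<forall>i. q i \<in> M" "q 0 = y" "q l = z" "c' = L q l"
      using cc unfolding C_def by blast
    define r where "r i = (if i \<le> k then p i else q (i - k))" for i
    have "L r (k + l) = (\<Sum>i<k. f (r i) (r (Suc i))) + (\<Sum>i<l. f (r (k + i)) (r (Suc (k + i))))"
      unfolding L_def by (induction l) auto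
    also have "(\<Sum>i<k. f (r i) (r (Suc i))) = L p k"
      unfolding L_def r_def by (intro sum.cong) auto
    also have "(\<Sum>i<l. f (r (k + i)) (r (Suc (k + i)))) = L q l"
      unfolding L_def r_def using p q by (intro sum.cong) (auto simp: Suc_diff_le)
    finally have "L r (k + l) = c + c'" using p q by simp
    moreover have "r 0 = x" "r (k + l) = z" "\<forall>i. r i \<in> M"
      using p q by (auto simp: r_def)
    ultimately show ?thesis
      by (auto simp: C_def intro!: exI[of _ r] exI[of _ "k+l"])
  qed
  have d_upper: "d x y \<le> f x y" if "x \<in> M" "y \<in> M" for x y
    using that f_in[OF that] bdd by (simp add: d_def cInf_lower)
  have d_lower: "f x y \<le> 2 * d x y" if "x \<in> M" "y \<in> M" for x y
  proof -
    have "f x y / 2 \<le> Inf (C x y)"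
      using f_in[OF that] lower by (intro cInf_greatest) (auto simp: field_simps)
    then show ?thesis using that by (simp add: d_def)
  qed
  have "Metric_space M d"
  proof
    fix x y
    show "0 \<le> d x y"
    proof (cases "x \<in> M \<and> y \<in> M")
      case True
      then show ?thesis using d_lower[of x y] nonneg[of x y] by linarith
    qed (auto simp: d_def)
    show "d x y = d y x"
      using C_sym[of x y] C_sym[of y x] by (auto simp: d_def)
    show "(d x y = 0) = (x = y)" if "x \<in> M" "y \<in> M"
    proof
      assume "d x y = 0"
      then show "x = y" using d_lower[OF that] nonneg[of x y] sep[OF that] by simp
    next
      assume "x = y"
      then show "d x y = 0" using d_lower[OF that] d_upper[OF that] refl[OF that(1)] by simp
    qed
    fix z
    assume M: "x \<in> M" "y \<in> M" "z \<in> M"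
    have "Inf (C x z) - c \<le> c'" if "c \<in> C x y" "c' \<in> C y z" for c c'
      using cInf_lower[OF C_concat[OF that] bdd] by simp
    then have "Inf (C x z) - c \<le> Inf (C y z)" if "c \<in> C x y" for c
      using that f_in[OF M(2,3)] by (intro cInf_greatest) auto
    then have "Inf (C x z) - Inf (C y z) \<le> c" if "c \<in> C x y" for c
      using that by (smt (verit))
    then have "Inf (C x z) - Inf (C y z) \<le> Inf (C x y)"
      using f_in[OF M(1,2)] by (intro cInf_greatest) auto
    then show "d x z \<le> d x y + d y z" using M by (simp add: d_def)
  qed
  then show thesis using d_upper d_lower that by blast
qed

text \<open>The classical metrization of a uniformity with a countable base. Only the sections of
  \<open>E n\<close> have to be neighbourhoods; \<open>f x y\<close> is a power of 1/2 recording the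
  first stage that separates \<open>x\<close> from \<open>y\<close>.\<close>

lemma metrizable_space_from_entourages:
  fixes E :: "nat \<Rightarrow> 'a \<Rightarrow> 'a \<Rightarrow> bool"
  assumes refl: "\<And>n x. x \<in> topspace X \<Longrightarrow> E n x x"
    and sym: "\<And>n x y. E n x y \<Longrightarrow> E n y x"
    and dec: "\<And>n x y. E (Suc n) x y \<Longrightarrow> E n x y"
    and comp: "\<And>n x y z. \<lbrakk>E (Suc n) x y; E (Suc n) y z\<rbrakk> \<Longrightarrow> E n x z"
    and nbhd: "\<And>n x. x \<in> topspace X \<Longrightarrow> \<exists>V. openin X V \<and> x \<in> V \<and> (\<forall>y\<in>V. E n x y)"
    and base: "\<And>x W. \<lbrakk>openin X W; x \<in> W\<rbrakk> \<Longrightarrow> \<exists>n. \<forall>y\<in>topspace X. E n x y \<longrightarrow> y \<in> W"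
    and "t1_space X"
  shows "metrizable_space X"
proof -
  \<comment> \<open>Every second stage is kept, because the quasi-triangle inequality needs a
    threefold composition and \<open>comp\<close> gives a twofold one.\<close>
  define F where "F n = E (2 * n)" for n
  have F3: "F n x w" if "F (Suc n) x y" "F (Suc n) y z" "F (Suc n) z w" for n x y z w
    using that unfolding F_def by (metis comp dec mult_Suc_right add_2_eq_Suc)
  have Fdec: "F (Suc n) x y \<Longrightarrow> F n x y" for n x y
    unfolding F_def by (metis dec mult_Suc_right add_2_eq_Suc)
  have Fmono: "F n x y \<Longrightarrow> m \<le> n \<Longrightarrow> F m x y" for m n x y
    by (induction n) (auto simp: le_Suc_eq dest: Fdec)
  define f :: "'a \<Rightarrow> 'a \<Rightarrow> real" where
    "f x y = (if \<forall>n. F n x y then 0 else (1/2) ^ (LEAST n. \<not> F n x y))" for x y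
  have f_ge: "(1/2) ^ n \<le> f x y" if "\<not> F n x y" for n x y
  proof -
    have "(LEAST n. \<not> F n x y) \<le> n" using that by (rule Least_le)
    then show ?thesis using that by (auto simp: f_def intro: power_decreasing)
  qed
  have f_le: "f x y \<le> (1/2) ^ n" if "F n x y" for n x y
  proof (cases "\<forall>n. F n x y")
    case False
    then have "\<not> F (LEAST n. \<not> F n x y) x y" by (metis (mono_tags, lifting) LeastI)
    then have "n \<le> (LEAST n. \<not> F n x y)" using that Fmono nle_le by blast
    then show ?thesis using False by (auto simp: f_def intro: power_decreasing)
  qed (simp add: f_def)
  have f_sym: "f x y = f y x" for x y
  proof -
    have "F n x y = F n y x" for n using sym by (auto simp: F_def)
    then show ?thesis by (simp add: f_def)
  qed
  have base': "\<exists>n. \<forall>y\<in>topspace X. F n x y \<longrightarrow> y \<in> W" if h: "openin X W" "x \<in> W" for x W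
  proof -
    obtain n where "\<forall>y\<in>topspace X. E n x y \<longrightarrow> y \<in> W" using base h by blast
    moreover have "F n x y \<Longrightarrow> E n x y" for y
    proof -
      have *: "E (n + k) x y \<Longrightarrow> E n x y" for k by (induction k) (auto dest: dec)
      show "F n x y \<Longrightarrow> E n x y" using *[of n] by (simp add: F_def mult_2)
    qed
    ultimately show ?thesis by blast
  qed
  have f0: "x = y" if h: "x \<in> topspace X" "y \<in> topspace X" "f x y = 0" for x y
  proof (rule ccontr)
    assume "x \<noteq> y"
    then obtain W where "openin X W" "x \<in> W" "y \<notin> W"
      using \<open>t1_space X\<close> h \<open>x \<noteq> y\<close> unfolding t1_space_def by blast
    then obtain n where "\<not> F n x y" using base' h by blast
    then show False using f_ge[of n x y] h zero_less_power[of "1/2::real" n] by linarith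
  qed
  obtain d where M: "Metric_space (topspace X) d"
    and le: "\<And>x y. \<lbrakk>x \<in> topspace X; y \<in> topspace X\<rbrakk> \<Longrightarrow> d x y \<le> f x y"
    and ge: "\<And>x y. \<lbrakk>x \<in> topspace X; y \<in> topspace X\<rbrakk> \<Longrightarrow> f x y \<le> 2 * d x y"
  proof (rule quasi_metric_imp_metric[of "topspace X" f])
    show "f x x = 0" if "x \<in> topspace X" for x using refl that by (simp add: f_def F_def)
    show "0 \<le> f x y" for x y by (simp add: f_def)
    show "f x w \<le> 2 * e"
      if "f x y \<le> e" "f y z \<le> e" "f z w \<le> e" for x y z w e
    proof (cases "\<forall>n. F n x w")
      case True
      then have "f x w = 0" by (simp add: f_def)
      moreover have "0 \<le> f x y" by (simp add: f_def)
      ultimately show ?thesis using that(1) by linarith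
    next
      case False
      define n where "n = (LEAST n. \<not> F n x w)"
      have n: "\<not> F n x w" unfolding n_def using False by (metis (mono_tags, lifting) LeastI)
      have fn: "f x w = (1/2) ^ n" using False by (simp add: f_def n_def)
      \<comment> \<open>Three steps at stage \<open>Suc n\<close> would compose to stage
        \<open>n\<close>, where \<open>x\<close> and \<open>w\<close> are apart. So one of them
        fails, which costs at least half of \<open>f x w\<close>.\<close>
      have "\<not> F (Suc n) x y \<or> \<not> F (Suc n) y z \<or> \<not> F (Suc n) z w" using F3 n by blast
      then have "(1/2) ^ Suc n \<le> e" using f_ge that by (meson order_trans)
      then show ?thesis using fn by simp
    qed
  qed (use f_sym f0 in auto)
  interpret Metric_space "topspace X" d by (rule M)
  have "openin mtopology U = openin X U" for U
  proof
    assume U: "openin mtopology U"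
    have UX: "U \<subseteq> topspace X" using U openin_mtopology by blast
    have "\<exists>V. openin X V \<and> x \<in> V \<and> V \<subseteq> U" if xU: "x \<in> U" for x
    proof -
      obtain r where r: "r > 0" "mball x r \<subseteq> U" using U xU openin_mtopology by blast
      obtain n where n: "(1/2::real) ^ n < r" using real_arch_pow_inv[of r "1/2"] r by auto
      obtain V where V: "openin X V" "x \<in> V" "\<forall>y\<in>V. F n x y"
        using nbhd[of x "2*n"] xU UX unfolding F_def by blast
      have "V \<subseteq> mball x r"
      proof
        fix y assume y: "y \<in> V"
        then have "y \<in> topspace X" using V openin_subset by blast
        moreover have "f x y < r" using f_le[of n x y] V n y by fastforce
        ultimately show "y \<in> mball x r" using le[of x y] xU UX by force
      qed
      then show ?thesis using V r by blast
    qed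
    then show "openin X U" by (subst openin_subopen) blast
  next
    assume U: "openin X U"
    have UX: "U \<subseteq> topspace X" using U openin_subset by blast
    moreover have "\<exists>r>0. mball x r \<subseteq> U" if x: "x \<in> U" for x
    proof -
      obtain n where n: "\<forall>y\<in>topspace X. F n x y \<longrightarrow> y \<in> U" using base' U x by blast
      have "mball x ((1/2) ^ Suc n) \<subseteq> U"
      proof
        fix y assume y: "y \<in> mball x ((1/2) ^ Suc n)"
        then have "f x y < (1/2) ^ n" using ge[of x y] by auto
        then have "F n x y" using f_ge by force
        then show "y \<in> U" using n y by auto
      qed
      then show ?thesis by (meson zero_less_power half_gt_zero zero_less_one)
    qed
    ultimately show "openin mtopology U" by (simp add: openin_mtopology)
  qed
  then have "mtopology = X" by (simp add: topology_eq)
  then show ?thesis using metrizable_space_mtopology by metis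
qed

text \<open>
  The neighbourhoods \<open>V k x\<close> are thinned out in such a way that two intersecting ones at
  stage \<open>Suc k\<close> lie together in one at stage \<open>k\<close>.
\<close>

theorem Frink_metrization:
  fixes B :: "nat \<Rightarrow> 'a \<Rightarrow> 'a set"
  assumes "t1_space X"
    and nbhd: "\<And>n x. x \<in> topspace X \<Longrightarrow> \<exists>V. openin X V \<and> x \<in> V \<and> V \<subseteq> B n x"
    and base: "\<And>x W. \<lbrakk>openin X W; x \<in> W\<rbrakk> \<Longrightarrow> \<exists>n. B n x \<subseteq> W"
    and dec: "\<And>m n x. m \<le> n \<Longrightarrow> B n x \<subseteq> B m x"
    and frink: "\<And>n x. x \<in> topspace X \<Longrightarrow>
      \<exists>m. \<forall>y\<in>topspace X. B m x \<inter> B m y \<noteq> {} \<longrightarrow> B m y \<subseteq> B n x"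
  shows "metrizable_space X"
proof -
  obtain \<mu> where \<mu>: "\<And>n x y. \<lbrakk>x \<in> topspace X; y \<in> topspace X; B (\<mu> x n) x \<inter> B (\<mu> x n) y \<noteq> {}\<rbrakk>
      \<Longrightarrow> B (\<mu> x n) y \<subseteq> B n x"
    using frink by metis
  \<comment> \<open>The index depends on the point. It dominates \<open>\<mu> x\<close> of the
    previous index, so that stage \<open>Suc k\<close> is fine enough for \<open>frink\<close> at
    stage \<open>k\<close>, and it increases strictly, so that it is at least \<open>k\<close> at
    every point.\<close>
  define N where "N k x = rec_nat 0 (\<lambda>_ n. max (\<mu> x n) (Suc n)) k" for k x
  have N_Suc: "N (Suc k) x = max (\<mu> x (N k x)) (Suc (N k x))" for k x by (simp add: N_def)
  have N_ge: "k \<le> N k x" for k x by (induction k) (auto simp: N_Suc)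
  define V where "V k x = B (N k x) x" for k x
  have V_dec: "V (Suc k) x \<subseteq> V k x" for k x unfolding V_def by (intro dec) (auto simp: N_Suc)
  \<comment> \<open>Of two points the one with the smaller index sets the scale, and its
    neighbourhood at stage \<open>k\<close> absorbs the other one.\<close>
  have absorb: "V (Suc k) y \<subseteq> V k x"
    if "x \<in> topspace X" "y \<in> topspace X" "V (Suc k) x \<inter> V (Suc k) y \<noteq> {}"
      "N (Suc k) x \<le> N (Suc k) y" for k x y
  proof -
    have "V (Suc k) x \<subseteq> B (\<mu> x (N k x)) x" "V (Suc k) y \<subseteq> B (\<mu> x (N k x)) y"
      unfolding V_def using that(4) by (intro dec; simp add: N_Suc)+
    then show ?thesis using \<mu>[OF that(1,2), of "N k x"] that(3) unfolding V_def by blast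
  qed
  define E where "E k x y \<longleftrightarrow> (\<exists>w\<in>topspace X. x \<in> V k w \<and> y \<in> V k w)" for k x y
  have in_V: "x \<in> V k x" if "x \<in> topspace X" for k x
    using nbhd[OF that] unfolding V_def by blast
  show ?thesis
  proof (rule metrizable_space_from_entourages[where E = E])
    show "E n x x" if "x \<in> topspace X" for n x using in_V that by (auto simp: E_def)
    show "E n x z" if "E (Suc n) x y" "E (Suc n) y z" for n x y z
    proof -
      obtain v w where v: "v \<in> topspace X" "x \<in> V (Suc n) v" "y \<in> V (Suc n) v"
        and w: "w \<in> topspace X" "y \<in> V (Suc n) w" "z \<in> V (Suc n) w"
        using \<open>E (Suc n) x y\<close> \<open>E (Suc n) y z\<close> unfolding E_def by blast
      show ?thesis
      proof (cases "N (Suc n) v \<le> N (Suc n) w")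
        case True
        then have "V (Suc n) w \<subseteq> V n v" using v w by (intro absorb) auto
        then show ?thesis using v w V_dec unfolding E_def by blast
      next
        case False
        then have "V (Suc n) v \<subseteq> V n w" using v w by (intro absorb) auto
        then show ?thesis using v w V_dec unfolding E_def by blast
      qed
    qed
    show "\<exists>U. openin X U \<and> x \<in> U \<and> (\<forall>y\<in>U. E n x y)" if "x \<in> topspace X" for n x
      using nbhd[OF that, of "N n x"] in_V[OF that, of n] that unfolding E_def V_def by blast
    show "\<exists>n. \<forall>y\<in>topspace X. E n x y \<longrightarrow> y \<in> W" if W: "openin X W" "x \<in> W" for x W
    proof -
      have x: "x \<in> topspace X" using W openin_subset by blast
      obtain n where n: "B n x \<subseteq> W" using base W by blast
      \<comment> \<open>If \<open>x\<close> lies in \<open>V m w\<close>, then \<open>B m x\<close>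
        and \<open>B m w\<close> share the point \<open>x\<close>, so \<open>\<mu>\<close> applies
        whatever the index \<open>N m w\<close> is.\<close>
      define m where "m = \<mu> x n"
      have "V m w \<subseteq> W" if "w \<in> topspace X" "x \<in> V m w" for w
      proof -
        have "V m w \<subseteq> B m w" unfolding V_def by (intro dec N_ge)
        moreover have "x \<in> B m x" using nbhd[OF x, of m] by blast
        ultimately show ?thesis using \<mu>[OF x that(1), of n] that(2) n unfolding m_def by blast
      qed
      then show ?thesis unfolding E_def by blast
    qed
  qed (use \<open>t1_space X\<close> V_dec in \<open>fastforce simp: E_def\<close>)+
qed

section \<open>Sequential spaces and countable networks\<close>

definition seq_closedin :: "'a topology \<Rightarrow> 'a set \<Rightarrow> bool" where
  "seq_closedin X A \<longleftrightarrow>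
     A \<subseteq> topspace X \<and> (\<forall>s x. range s \<subseteq> A \<and> limitin X s x sequentially \<longrightarrow> x \<in> A)"

lemma seq_closedinD:
  "\<lbrakk>seq_closedin X A; \<And>n. s n \<in> A; limitin X s x sequentially\<rbrakk> \<Longrightarrow> x \<in> A"
  unfolding seq_closedin_def by blast

lemma sequential_space_iff:
  "sequential_space X \<longleftrightarrow> (\<forall>A. seq_closedin X A \<longrightarrow> closedin X A)"
  unfolding sequential_space_def seq_closedin_def
  by (metis Diff_iff limitin_topspace)

lemma closedin_limitin_sequentially:
  "\<lbrakk>closedin X A; \<And>n. s n \<in> A; limitin X s x sequentially\<rbrakk> \<Longrightarrow> x \<in> A"
  by (rule limitin_closedin[of X s x sequentially A]) auto

lemma closedin_imp_seq_closedin: "closedin X A \<Longrightarrow> seq_closedin X A"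
  unfolding seq_closedin_def
  by (meson closedin_limitin_sequentially closedin_subset rangeI subsetD)

lemma seq_closedin_Int:
  assumes "seq_closedin X A" "seq_closedin X B"
  shows "seq_closedin X (A \<inter> B)"
  unfolding seq_closedin_def
proof (intro conjI allI impI)
  show "A \<inter> B \<subseteq> topspace X" using assms(1) by (auto simp: seq_closedin_def)
  fix s :: "nat \<Rightarrow> 'a" and x assume s: "range s \<subseteq> A \<inter> B \<and> limitin X s x sequentially"
  have "x \<in> A" by (rule seq_closedinD[OF assms(1)]) (use s in auto)
  moreover have "x \<in> B" by (rule seq_closedinD[OF assms(2)]) (use s in auto)
  ultimately show "x \<in> A \<inter> B" by simp
qed

lemma metrizable_imp_sequential_space:
  assumes "metrizable_space X"
  shows "sequential_space X"
proof -
  obtain M d where "Metric_space M d" "X = Metric_space.mtopology M d"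
    using assms unfolding metrizable_space_def by blast
  then show ?thesis
    by (simp add: sequential_space_iff seq_closedin_def Metric_space.topspace_mtopology
        Metric_space.metric_closedin_iff_sequentially_closed)
qed

lemma compactin_convergent_sequence:
  assumes "limitin X s x sequentially" "range s \<subseteq> topspace X"
  shows "compactin X (insert x (range s))"
  unfolding compactin_def
proof (intro conjI allI impI)
  have x: "x \<in> topspace X" using assms(1) limitin_topspace by metis
  then show "insert x (range s) \<subseteq> topspace X" using assms(2) by blast
  fix \<U> assume \<U>: "(\<forall>U\<in>\<U>. openin X U) \<and> insert x (range s) \<subseteq> \<Union>\<U>"
  then obtain U where U: "U \<in> \<U>" "x \<in> U" by blast
  then obtain N where N: "\<And>n. n \<ge> N \<Longrightarrow> s n \<in> U"
    using \<U> assms(1) unfolding limitin_sequentially by meson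
  have "\<forall>n. \<exists>V\<in>\<U>. s n \<in> V" using \<U> by blast
  then obtain V where V: "\<And>n. V n \<in> \<U> \<and> s n \<in> V n" by metis
  have "insert x (range s) \<subseteq> \<Union>(insert U (V ` {..<N}))"
  proof -
    have "s n \<in> \<Union>(insert U (V ` {..<N}))" for n
      using N[of n] V[of n] by (cases "n < N") auto
    then show ?thesis using U by blast
  qed
  then show "\<exists>\<F>. finite \<F> \<and> \<F> \<subseteq> \<U> \<and> insert x (range s) \<subseteq> \<Union>\<F>"
    using U V by (intro exI[of _ "insert U (V ` {..<N})"]) auto
qed

text \<open>A convergent sequence together with its limit is a compact test set.\<close>

lemma sequential_imp_k_space:
  assumes "sequential_space X"
  shows "k_space X"
  unfolding k_space_def
proof (intro allI impI iffI)
  fix S K assume "closedin X S" "compactin X K"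
  then show "closedin (subtopology X K) (K \<inter> S)"
    by (metis closedin_subtopology_Int_closed)
next
  fix S assume S: "S \<subseteq> topspace X"
    and *: "\<forall>K. compactin X K \<longrightarrow> closedin (subtopology X K) (K \<inter> S)"
  have "seq_closedin X S"
    unfolding seq_closedin_def
  proof (intro conjI allI impI S)
    fix s :: "nat \<Rightarrow> 'a" and x assume h: "range s \<subseteq> S \<and> limitin X s x sequentially"
    define K where "K = insert x (range s)"
    have "compactin X K" unfolding K_def using h S by (intro compactin_convergent_sequence) auto
    then have "closedin (subtopology X K) (K \<inter> S)" using * by blast
    moreover have "limitin (subtopology X K) s x sequentially"
      using h by (simp add: limitin_subtopology K_def)
    ultimately show "x \<in> S"
      using closedin_limitin_sequentially[of "subtopology X K" "K \<inter> S" s x] h by (auto simp: K_def)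
  qed
  then show "closedin X S" using assms sequential_space_iff by blast
qed

text \<open>A compact set is metrized by any coarser metric, so its topology is sequential.\<close>

lemma seq_closedin_compact_submetrizable:
  assumes Z: "submetrizable_space Z" "Hausdorff_space Z" "compactin Z K"
    and B: "B \<subseteq> K" "seq_closedin Z B"
  shows "closedin Z B"
proof -
  obtain Y where Y: "topspace Y = topspace Z" "\<And>U. openin Y U \<Longrightarrow> openin Z U" "metrizable_space Y"
    using Z(1) unfolding submetrizable_space_def by blast
  have closed_YZ: "closedin Z C" if "closedin Y C" for C
    using that Y by (auto simp: closedin_def)
  have compact_ZY: "compactin Y C" if "compactin Z C" for C
    using that Y unfolding compactin_def by metis
  have lim_YZ: "limitin Z s x sequentially"
    if "range s \<subseteq> K" "x \<in> K" "limitin Y s x sequentially" for s x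
    unfolding limitin_def
  proof (intro conjI allI impI)
    show "x \<in> topspace Z" using that compactin_subset_topspace[OF Z(3)] by blast
    fix W assume W: "openin Z W \<and> x \<in> W"
    \<comment> \<open>Compactness passes to the coarser Hausdorff topology \<open>Y\<close> and
      makes \<open>K - W\<close> closed there. Its complement is a \<open>Y\<close>-neighbourhood of
      \<open>x\<close> that agrees with \<open>W\<close> on \<open>K\<close>.\<close>
    have "compactin Z (K - W)" using Z(3) W
      by (metis Diff_subset closed_compactin closedin_diff closedin_topspace Int_Diff Int_absorb2
          compact_imp_compactin_subtopology compactin_subset_topspace compactin_imp_closedin Z(2))
    then have "closedin Y (K - W)"
      using compact_ZY Y(3) compactin_imp_closedin metrizable_imp_Hausdorff_space by blast
    then have "openin Y (topspace Y - (K - W))" by blast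
    moreover have "x \<in> topspace Y - (K - W)" using W \<open>x \<in> topspace Z\<close> Y(1) by simp
    ultimately have "\<forall>\<^sub>F n in sequentially. s n \<in> topspace Y - (K - W)"
      using that(3) unfolding limitin_def by blast
    then show "\<forall>\<^sub>F n in sequentially. s n \<in> W"
      by (rule eventually_mono) (use that(1) in auto)
  qed
  have "seq_closedin Y B"
    unfolding seq_closedin_def
  proof (intro conjI allI impI)
    show "B \<subseteq> topspace Y" using B Y by (simp add: seq_closedin_def)
    fix s :: "nat \<Rightarrow> 'a" and x assume h: "range s \<subseteq> B \<and> limitin Y s x sequentially"
    have "closedin Y K" using compact_ZY[OF Z(3)] Y(3) compactin_imp_closedin
        metrizable_imp_Hausdorff_space by blast
    then have "x \<in> K" using h B closedin_limitin_sequentially[of Y K s x] by blast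
    then show "x \<in> B" using lim_YZ[of s x] h B unfolding seq_closedin_def by blast
  qed
  then show ?thesis using closed_YZ metrizable_imp_sequential_space[OF Y(3)] sequential_space_iff by blast
qed

text \<open>A network for the subspace \<open>Q\<close>, tested with the open sets of
  \<open>X\<close>. Its members may be non-open and may stick out of \<open>Q\<close>, as translates
  of \<open>D s\<close> do.\<close>

definition countable_network :: "'a topology \<Rightarrow> 'a set \<Rightarrow> bool" where
  "countable_network X Q \<longleftrightarrow>
     (\<exists>\<N>. countable \<N> \<and> (\<forall>z\<in>Q. \<forall>W. openin X W \<and> z \<in> W \<longrightarrow> (\<exists>N\<in>\<N>. z \<in> N \<and> N \<subseteq> W)))"

lemma countable_network_subtopology:
  assumes "countable_network X Q" "Q \<subseteq> H"
  shows "countable_network (subtopology X H) Q"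
proof -
  obtain \<N> where \<N>: "countable \<N>"
    "\<And>z W. \<lbrakk>z \<in> Q; openin X W; z \<in> W\<rbrakk> \<Longrightarrow> \<exists>N\<in>\<N>. z \<in> N \<and> N \<subseteq> W"
    using assms unfolding countable_network_def by meson
  show ?thesis
    unfolding countable_network_def
  proof (intro exI[of _ "(\<lambda>N. N \<inter> H) ` \<N>"] conjI ballI allI impI)
    fix z W assume z: "z \<in> Q" and W: "openin (subtopology X H) W \<and> z \<in> W"
    then obtain V where V: "openin X V" "W = V \<inter> H" by (auto simp: openin_subtopology)
    then obtain N where "N \<in> \<N>" "z \<in> N" "N \<subseteq> V" using \<N>(2)[OF z, of V] W by blast
    moreover have "z \<in> H" using z assms(2) by blast
    ultimately show "\<exists>N\<in>(\<lambda>N. N \<inter> H) ` \<N>. z \<in> N \<and> N \<subseteq> W"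
      using V(2) by (intro bexI[of _ "N \<inter> H"]) auto
  qed (use \<N> in auto)
qed

lemma countable_network_Union:
  assumes "\<And>n::nat. countable_network X (Q n)"
  shows "countable_network X (\<Union>n. Q n)"
proof -
  have "\<forall>n. \<exists>\<N>. countable \<N> \<and> (\<forall>z\<in>Q n. \<forall>W. openin X W \<and> z \<in> W \<longrightarrow> (\<exists>N\<in>\<N>. z \<in> N \<and> N \<subseteq> W))"
    using assms unfolding countable_network_def by blast
  then obtain \<N> where \<N>: "\<And>n. countable (\<N> n)"
    "\<And>n z W. \<lbrakk>z \<in> Q n; openin X W; z \<in> W\<rbrakk> \<Longrightarrow> \<exists>N\<in>\<N> n. z \<in> N \<and> N \<subseteq> W" by metis
  show ?thesis
    unfolding countable_network_def
  proof (intro exI[of _ "\<Union>n. \<N> n"] conjI ballI allI impI)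
    fix z W assume "z \<in> (\<Union>n. Q n)" "openin X W \<and> z \<in> W"
    then show "\<exists>N\<in>\<Union>(range \<N>). z \<in> N \<and> N \<subseteq> W" using \<N>(2) by (metis UN_iff)
  qed (use \<N> in auto)
qed

text \<open>The Lindelof property: for each network set that fits into some member of the cover, one
  such member is kept.\<close>

lemma countable_network_subcover:
  assumes "countable_network X Q" "\<And>U. U \<in> \<U> \<Longrightarrow> openin X U" "Q \<subseteq> \<Union>\<U>"
  shows "\<exists>\<V>. countable \<V> \<and> \<V> \<subseteq> \<U> \<and> Q \<subseteq> \<Union>\<V>"
proof -
  obtain \<N> where \<N>: "countable \<N>"
    "\<And>z W. \<lbrakk>z \<in> Q; openin X W; z \<in> W\<rbrakk> \<Longrightarrow> \<exists>N\<in>\<N>. z \<in> N \<and> N \<subseteq> W"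
    using assms unfolding countable_network_def by meson
  define \<N>' where "\<N>' = {N \<in> \<N>. \<exists>U\<in>\<U>. N \<subseteq> U}"
  have "\<forall>N\<in>\<N>'. \<exists>U. U \<in> \<U> \<and> N \<subseteq> U" unfolding \<N>'_def by blast
  from bchoice[OF this] obtain g where g: "\<And>N. N \<in> \<N>' \<Longrightarrow> g N \<in> \<U> \<and> N \<subseteq> g N"
    by blast
  show ?thesis
  proof (intro exI conjI)
    show "countable (g ` \<N>')" using \<N>(1) by (simp add: \<N>'_def)
    show "g ` \<N>' \<subseteq> \<U>" using g by blast
    show "Q \<subseteq> \<Union>(g ` \<N>')"
    proof
      fix z assume z: "z \<in> Q"
      then obtain U where U: "U \<in> \<U>" "z \<in> U" using assms(3) by blast
      then obtain N where "N \<in> \<N>" "z \<in> N" "N \<subseteq> U" using \<N>(2)[OF z] assms(2) by blast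
      then have "N \<in> \<N>'" using U by (auto simp: \<N>'_def)
      then show "z \<in> \<Union>(g ` \<N>')" using g \<open>z \<in> N\<close> by blast
    qed
  qed
qed

text \<open>The network reduces an open cover to a countable one. If no finite part of it covered
  \<open>Q\<close>, points missed by the first \<open>n\<close> sets would have a subsequential
  limit, and the set \<open>V k\<close> around this limit would contain terms chosen to avoid
  it.\<close>

lemma compactin_of_sequentially_compact:
  assumes "countable_network X Q" "Q \<subseteq> topspace X"
    and seq: "\<And>s :: nat \<Rightarrow> 'a. range s \<subseteq> Q \<Longrightarrow> \<exists>r x. strict_mono (r :: nat \<Rightarrow> nat) \<and> x \<in> Q \<and> limitin X (s \<circ> r) x sequentially"
  shows "compactin X Q"
  unfolding compactin_def
proof (intro conjI allI impI)
  show "Q \<subseteq> topspace X" by (rule assms(2))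
  fix \<U> assume \<U>: "(\<forall>U\<in>\<U>. openin X U) \<and> Q \<subseteq> \<Union>\<U>"
  obtain \<V> where \<V>: "countable \<V>" "\<V> \<subseteq> \<U>" "Q \<subseteq> \<Union>\<V>"
    using countable_network_subcover[OF assms(1), of \<U>] \<U> by auto
  show "\<exists>\<F>. finite \<F> \<and> \<F> \<subseteq> \<U> \<and> Q \<subseteq> \<Union>\<F>"
  proof (cases "Q = {}")
    case False
    then have "\<V> \<noteq> {}" using \<V> by blast
    define V where "V = from_nat_into \<V>"
    have V: "range V = \<V>" using \<V> \<open>\<V> \<noteq> {}\<close> by (simp add: V_def)
    have "\<exists>n. Q \<subseteq> \<Union>(V ` {..<n})"
    proof (rule ccontr)
      assume "\<not> ?thesis"
      then have "\<forall>n. \<exists>x. x \<in> Q \<and> x \<notin> \<Union>(V ` {..<n})" by blast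
      then obtain s where s: "\<And>n. s n \<in> Q \<and> s n \<notin> \<Union>(V ` {..<n})" by metis
      then obtain r x where r: "strict_mono r" "x \<in> Q" "limitin X (s \<circ> r) x sequentially"
        using seq[of s] by blast
      obtain k where k: "x \<in> V k" using r V \<V> by blast
      have "openin X (V k)" using V \<V> \<U> by blast
      then have "\<forall>\<^sub>F n in sequentially. s (r n) \<in> V k" using r k by (simp add: limitin_def)
      moreover have "\<forall>\<^sub>F n in sequentially. r n > k"
        using eventually_gt_at_top[of k] by eventually_elim (use seq_suble[OF r(1)] in \<open>metis order_less_le_trans\<close>)
      ultimately have "\<forall>\<^sub>F n in sequentially. False"
        by eventually_elim (use s in blast)
      then show False by simp
    qed
    then obtain n where "Q \<subseteq> \<Union>(V ` {..<n})" by blast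
    then show ?thesis using V \<V> by (intro exI[of _ "V ` {..<n}"]) auto
  qed auto
qed

lemma regular_space_closure_of:
  assumes "regular_space X" "openin X U" "x \<in> U"
  shows "\<exists>V. openin X V \<and> x \<in> V \<and> X closure_of V \<subseteq> U"
proof -
  have "neighbourhood_base_of (closedin X) X"
    using assms(1) neighbourhood_base_of_closedin by blast
  then have "\<exists>V C. openin X V \<and> closedin X C \<and> x \<in> V \<and> V \<subseteq> C \<and> C \<subseteq> U"
    using assms(2,3) by (simp add: neighbourhood_base_of)
  then obtain V C where VC: "openin X V" "closedin X C" "x \<in> V" "V \<subseteq> C" "C \<subseteq> U"
    by (elim exE conjE)
  have "X closure_of V \<subseteq> C" using VC(4,2) by (rule closure_of_minimal)
  then have "X closure_of V \<subseteq> U" using VC(5) by (rule order_trans)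
  then show ?thesis using VC(1,3) by (intro exI[of _ V] conjI)
qed

text \<open>Regular and Lindelof imply normal, so two network sets with disjoint closures have a
  Urysohn function. There are countably many such pairs and they separate points, so the functions
  inject \<open>Z\<close> continuously into a countable power of the line.\<close>

lemma submetrizable_of_countable_network:
  assumes "regular_space Z" "Hausdorff_space Z" "countable_network Z (topspace Z)"
  shows "submetrizable_space Z"
proof -
  have "Lindelof_space Z"
    unfolding Lindelof_space_def
  proof (intro allI impI)
    fix \<U> assume \<U>: "(\<forall>U\<in>\<U>. openin Z U) \<and> \<Union>\<U> = topspace Z"
    have "\<exists>\<V>. countable \<V> \<and> \<V> \<subseteq> \<U> \<and> topspace Z \<subseteq> \<Union>\<V>"
    proof (rule countable_network_subcover[OF assms(3)])
      show "openin Z U" if "U \<in> \<U>" for U using \<U> that by blast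
      show "topspace Z \<subseteq> \<Union>\<U>" using \<U> by simp
    qed
    then obtain \<V> where \<V>: "countable \<V>" "\<V> \<subseteq> \<U>" "topspace Z \<subseteq> \<Union>\<V>" by (elim exE conjE)
    moreover have "\<Union>\<V> \<subseteq> topspace Z" using Union_mono[OF \<V>(2)] \<U> by simp
    ultimately show "\<exists>\<V>. countable \<V> \<and> \<V> \<subseteq> \<U> \<and> \<Union>\<V> = topspace Z"
      by (intro exI[of _ \<V>] conjI subset_antisym)
  qed
  then have normal: "normal_space Z" by (rule regular_Lindelof_imp_normal_space[OF assms(1)])
  obtain \<N> where \<N>: "countable \<N>"
    "\<And>z W. \<lbrakk>z \<in> topspace Z; openin Z W; z \<in> W\<rbrakk> \<Longrightarrow> \<exists>N\<in>\<N>. z \<in> N \<and> N \<subseteq> W"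
    using assms(3) unfolding countable_network_def by meson
  have "\<exists>f. continuous_map Z euclideanreal f \<and>
      (disjnt (Z closure_of fst p) (Z closure_of snd p) \<longrightarrow>
        f ` (Z closure_of fst p) \<subseteq> {0} \<and> f ` (Z closure_of snd p) \<subseteq> {1})" for p
  proof (cases "disjnt (Z closure_of fst p) (Z closure_of snd p)")
    case True
    obtain g where "continuous_map Z euclideanreal g"
      "g ` (Z closure_of fst p) \<subseteq> {0}" "g ` (Z closure_of snd p) \<subseteq> {1}"
      by (rule Urysohn_lemma_alt[OF normal closedin_closure_of closedin_closure_of True, of 0 1])
    then show ?thesis by blast
  next
    case False
    then show ?thesis by (intro exI[of _ "\<lambda>_. 0"]) auto
  qed
  then obtain f where f: "\<And>p. continuous_map Z euclideanreal (f p)"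
    "\<And>p. disjnt (Z closure_of fst p) (Z closure_of snd p) \<Longrightarrow>
        f p ` (Z closure_of fst p) \<subseteq> {0} \<and> f p ` (Z closure_of snd p) \<subseteq> {1}" by metis
  define \<phi> where "\<phi> x = (\<lambda>k. f (from_nat_into (\<N> \<times> \<N>) k) x)" for x
  have "continuous_map Z (product_topology (\<lambda>i::nat. euclideanreal) UNIV) \<phi>"
    using f(1) by (simp add: continuous_map_componentwise_UNIV \<phi>_def)
  then have cont: "continuous_map Z euclidean \<phi>" by (simp add: euclidean_product_topology)
  have inj: "x = y" if xy: "x \<in> topspace Z" "y \<in> topspace Z" "\<phi> x = \<phi> y" for x y
  proof (rule ccontr)
    assume "x \<noteq> y"
    then obtain U V where UV: "openin Z U" "openin Z V" "x \<in> U" "y \<in> V" "disjnt U V"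
      using assms(2) xy unfolding Hausdorff_space_def by meson
    obtain U' where U': "openin Z U'" "x \<in> U'" "Z closure_of U' \<subseteq> U"
      using regular_space_closure_of[OF assms(1) UV(1,3)] by blast
    obtain V' where V': "openin Z V'" "y \<in> V'" "Z closure_of V' \<subseteq> V"
      using regular_space_closure_of[OF assms(1) UV(2,4)] by blast
    obtain M where M: "M \<in> \<N>" "x \<in> M" "M \<subseteq> U'" using \<N>(2) xy U' by blast
    obtain N where N: "N \<in> \<N>" "y \<in> N" "N \<subseteq> V'" using \<N>(2) xy V' by blast
    have "Z closure_of M \<subseteq> U" "Z closure_of N \<subseteq> V"
      using M N U' V' closure_of_mono by (metis order_trans)+
    then have dj: "disjnt (Z closure_of M) (Z closure_of N)" using UV by (auto simp: disjnt_def)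
    have "x \<in> Z closure_of M" "y \<in> Z closure_of N"
      using M N xy by (auto simp: in_closure_of)
    then have "f (M, N) x = 0" "f (M, N) y = 1" using f(2)[of "(M, N)"] dj by auto
    moreover obtain k where "from_nat_into (\<N> \<times> \<N>) k = (M, N)"
      using from_nat_into_surj[of "\<N> \<times> \<N>" "(M, N)"] \<N>(1) M N by auto
    ultimately show False using xy(3) by (metis \<phi>_def zero_neq_one)
  qed
  \<comment> \<open>The metric of the countable power is pulled back along \<open>\<phi>\<close>;
    continuity of \<open>\<phi>\<close> makes the resulting topology coarser than that of
    \<open>Z\<close>.\<close>
  interpret Metric_space "topspace Z" "\<lambda>x y. dist (\<phi> x) (\<phi> y)"
    by unfold_locales (auto simp: dist_commute dist_triangle inj)
  have "openin Z U" if U: "openin mtopology U" for U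
  proof -
    have UZ: "U \<subseteq> topspace Z" using U openin_mtopology by blast
    have "\<exists>V. openin Z V \<and> x \<in> V \<and> V \<subseteq> U" if x: "x \<in> U" for x
    proof -
      obtain r where r: "r > 0" "mball x r \<subseteq> U" using U x openin_mtopology by blast
      have "openin Z {y \<in> topspace Z. \<phi> y \<in> ball (\<phi> x) r}"
        by (rule openin_continuous_map_preimage[OF cont]) simp
      moreover have "{y \<in> topspace Z. \<phi> y \<in> ball (\<phi> x) r} = mball x r" using x UZ by auto
      ultimately show ?thesis using r x UZ by (intro exI[of _ "mball x r"]) auto
    qed
    then show ?thesis by (subst openin_subopen) blast
  qed
  then show ?thesis
    unfolding submetrizable_space_def
    by (intro exI[of _ mtopology]) (simp add: metrizable_space_mtopology)
qed

section \<open>Gyrogroups\<close>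

context gyrogroup
begin

lemmas closed_ops = oplus_closed zero_closed neg_closed

lemma zero_left [simp]: "a \<in> G \<Longrightarrow> \<zero> \<oplus> a = a"
  and zero_right [simp]: "a \<in> G \<Longrightarrow> a \<oplus> \<zero> = a"
  and neg_left [simp]: "a \<in> G \<Longrightarrow> \<ominus> a \<oplus> a = \<zero>"
  and neg_right [simp]: "a \<in> G \<Longrightarrow> a \<oplus> \<ominus> a = \<zero>"
  using identity inverse by auto

lemma gyr_bij: "\<lbrakk>x \<in> G; y \<in> G\<rbrakk> \<Longrightarrow> bij_betw (gyr x y) G G"
  and gyr_hom: "\<lbrakk>x \<in> G; y \<in> G; a \<in> G; b \<in> G\<rbrakk> \<Longrightarrow> gyr x y (a \<oplus> b) = gyr x y a \<oplus> gyr x y b"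
  using gyr_automorphism[of x y] unfolding gyro_automorphism_def by auto

lemma gyr_closed: "\<lbrakk>x \<in> G; y \<in> G; z \<in> G\<rbrakk> \<Longrightarrow> gyr x y z \<in> G"
  using gyr_bij[of x y] bij_betwE by blast

lemma gyr_inj: "\<lbrakk>x \<in> G; y \<in> G; a \<in> G; b \<in> G; gyr x y a = gyr x y b\<rbrakk> \<Longrightarrow> a = b"
  using gyr_bij[of x y] unfolding bij_betw_def inj_on_def by blast

text \<open>Adding \<open>\<ominus> a\<close> on the left turns both sides into values of the same
  gyration \<open>gyr (\<ominus> a) a\<close>, which is injective. That it is the identity comes out
  only in \<open>left_cancel\<close>.\<close>

lemma oplus_left_inj:
  assumes "a \<in> G" "b \<in> G" "c \<in> G" "a \<oplus> b = a \<oplus> c"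
  shows "b = c"
proof -
  have "gyr (\<ominus> a) a b = \<ominus> a \<oplus> (a \<oplus> b)" "gyr (\<ominus> a) a c = \<ominus> a \<oplus> (a \<oplus> c)"
    using assms gyro_assoc[of "\<ominus> a" a b] gyro_assoc[of "\<ominus> a" a c]
    by (simp_all add: closed_ops gyr_closed)
  then have "gyr (\<ominus> a) a b = gyr (\<ominus> a) a c" using assms(4) by simp
  then show ?thesis using assms gyr_inj[of "\<ominus> a" a b c] by (simp add: closed_ops)
qed

lemma gyr_zero_left:
  assumes "a \<in> G" "z \<in> G"
  shows "gyr \<zero> a z = z"
proof -
  have "a \<oplus> z = a \<oplus> gyr \<zero> a z"
    using gyro_assoc[of \<zero> a z] assms by (simp add: closed_ops)
  then show ?thesis using assms oplus_left_inj[of a "gyr \<zero> a z" z] by (simp add: closed_ops gyr_closed)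
qed

lemma left_cancel [simp]:
  assumes "a \<in> G" "z \<in> G"
  shows "\<ominus> a \<oplus> (a \<oplus> z) = z"
proof -
  have "\<ominus> a \<oplus> (a \<oplus> z) = gyr (\<ominus> a) a z"
    using gyro_assoc[of "\<ominus> a" a z] assms by (simp add: closed_ops gyr_closed)
  \<comment> \<open>The loop property applies because
    \<open>\<ominus> a \<oplus> a = \<zero>\<close>.\<close>
  also have "\<dots> = gyr \<zero> a z"
    using loop_property[of "\<ominus> a" a z] assms by (simp add: closed_ops)
  finally show ?thesis using gyr_zero_left assms by simp
qed

lemma neg_neg [simp]: "a \<in> G \<Longrightarrow> \<ominus> (\<ominus> a) = a"
  using inverse_unique[of "\<ominus> a" a] by (simp add: closed_ops)

lemma left_cancel' [simp]: "\<lbrakk>a \<in> G; z \<in> G\<rbrakk> \<Longrightarrow> a \<oplus> (\<ominus> a \<oplus> z) = z"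
  using left_cancel[of "\<ominus> a" z] by (simp add: closed_ops)

lemma neg_zero [simp]: "\<ominus> \<zero> = \<zero>"
  using neg_right[OF zero_closed] zero_left[of "\<ominus> \<zero>"] by (simp add: closed_ops)

text \<open>The gyrator identity. It makes gyrations words in the operations, so they map every
  subset closed under \<open>\<oplus>\<close> and \<open>\<ominus>\<close> into itself.\<close>

lemma gyr_formula:
  assumes "x \<in> G" "y \<in> G" "z \<in> G"
  shows "gyr x y z = \<ominus> (x \<oplus> y) \<oplus> (x \<oplus> (y \<oplus> z))"
  using gyro_assoc[of x y z] assms by (simp add: closed_ops gyr_closed)

text \<open>\<open>rsolve p v\<close> is the solution \<open>y\<close> of \<open>y \<oplus> v = p\<close>.\<close>

definition rsolve :: "'a \<Rightarrow> 'a \<Rightarrow> 'a" where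
  "rsolve p v = p \<oplus> (\<ominus> (p \<oplus> v) \<oplus> p)"

text \<open>Gyroassociativity for \<open>y\<close>, \<open>v\<close>, \<open>\<ominus> v\<close>
  reads \<open>y = p \<oplus> gyr y v (\<ominus> v)\<close> with \<open>p = y \<oplus> v\<close>.
  The loop property replaces \<open>gyr y v\<close> by \<open>gyr p v\<close>, which removes the
  unknown \<open>y\<close> from the right side.\<close>

lemma rsolve_oplus:
  assumes "y \<in> G" "v \<in> G"
  shows "rsolve (y \<oplus> v) v = y"
proof -
  define p where "p = y \<oplus> v"
  have p: "p \<in> G" using assms by (simp add: p_def closed_ops)
  have "gyr y v (\<ominus> v) = gyr p v (\<ominus> v)"
    using loop_property[of y v "\<ominus> v"] assms by (simp add: p_def closed_ops)
  also have "\<dots> = \<ominus> (p \<oplus> v) \<oplus> p"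
    using gyr_formula[of p v "\<ominus> v"] assms p by (simp add: closed_ops)
  finally have "y \<oplus> (v \<oplus> \<ominus> v) = p \<oplus> (\<ominus> (p \<oplus> v) \<oplus> p)"
    using gyro_assoc[of y v "\<ominus> v"] assms by (simp add: p_def closed_ops)
  then show ?thesis using assms by (simp add: rsolve_def p_def)
qed

lemma rsolve_zero: "y \<in> G \<Longrightarrow> rsolve y \<zero> = y"
  using rsolve_oplus[of y \<zero>] by (simp add: closed_ops)

lemma subgyrogroup_closed:
  assumes "H \<subseteq> G" "\<zero> \<in> H"
    and opl: "\<And>x y. \<lbrakk>x \<in> H; y \<in> H\<rbrakk> \<Longrightarrow> x \<oplus> y \<in> H"
    and ngt: "\<And>x. x \<in> H \<Longrightarrow> \<ominus> x \<in> H"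
  shows "subgyrogroup G (\<oplus>) gyr H"
proof -
  have HG: "x \<in> H \<Longrightarrow> x \<in> G" for x using assms(1) by blast
  have gyrH: "gyr a b c \<in> H" if "a \<in> H" "b \<in> H" "c \<in> H" for a b c
    using that by (simp add: gyr_formula HG opl ngt)
  have auto_H: "gyro_automorphism H (\<oplus>) (gyr a b)" if ab: "a \<in> H" "b \<in> H" for a b
    unfolding gyro_automorphism_def
  proof (intro conjI ballI)
    show "bij_betw (gyr a b) H H"
      unfolding bij_betw_def
    proof
      show "inj_on (gyr a b) H"
        using gyr_inj[of a b] HG ab unfolding inj_on_def by blast
      show "gyr a b ` H = H"
      proof
        show "gyr a b ` H \<subseteq> H" using gyrH ab by blast
        show "H \<subseteq> gyr a b ` H"
        proof
          fix d assume d: "d \<in> H"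
          \<comment> \<open>Solves \<open>gyr a b c = d\<close> by undoing the three left
            translations in \<open>gyr_formula\<close>.\<close>
          define c where "c = \<ominus> b \<oplus> (\<ominus> a \<oplus> ((a \<oplus> b) \<oplus> d))"
          have c: "c \<in> H" using ab d by (simp add: c_def opl ngt)
          have "gyr a b c = d"
            using ab d c by (simp add: gyr_formula HG) (simp add: c_def HG closed_ops)
          then show "d \<in> gyr a b ` H" using c by blast
        qed
      qed
    qed
    show "gyr a b (x \<oplus> y) = gyr a b x \<oplus> gyr a b y" if "x \<in> H" "y \<in> H" for x y
      using that ab gyr_hom HG by blast
  qed
  have "gyrogroup H (\<oplus>) \<zero> neg gyr"
  proof
    show "e = \<zero>" if "e \<in> H" "\<forall>a\<in>H. e \<oplus> a = a \<and> a \<oplus> e = a" for e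
      using that assms(2) HG by (metis zero_right)
    show "y = \<ominus> x" if "x \<in> H" "y \<in> H" "y \<oplus> x = \<zero>" "x \<oplus> y = \<zero>" for x y
      using that HG inverse_unique by blast
  qed (use assms HG auto_H gyro_assoc loop_property in auto)
  then show ?thesis
    unfolding subgyrogroup_def using assms auto_H by blast
qed

end

section \<open>Continuity, neighbourhoods of the identity and regularity\<close>

context topological_gyrogroup
begin

lemma continuous_map_oplus:
  assumes "continuous_map Y X f" "continuous_map Y X g"
  shows "continuous_map Y X (\<lambda>y. f y \<oplus> g y)"
proof -
  have "continuous_map Y (prod_topology X X) (\<lambda>y. (f y, g y))"
    using assms by (simp add: continuous_map_pairedI)
  from continuous_map_compose[OF this continuous_oplus] show ?thesis by (simp add: o_def)
qed

lemma continuous_map_neg: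
  assumes "continuous_map Y X f"
  shows "continuous_map Y X (\<lambda>y. \<ominus> (f y))"
  using continuous_map_compose[OF assms continuous_neg] by (simp add: o_def)

lemma continuous_map_rsolve:
  assumes "continuous_map Y X f" "continuous_map Y X g"
  shows "continuous_map Y X (\<lambda>y. rsolve (f y) (g y))"
  unfolding rsolve_def by (intro continuous_map_oplus continuous_map_neg assms)

lemmas continuous_map_gyro = continuous_map_oplus continuous_map_neg continuous_map_rsolve

lemma continuous_map_ltrans: "x \<in> topspace X \<Longrightarrow> continuous_map X X (\<lambda>y. x \<oplus> y)"
  by (intro continuous_map_oplus) (auto simp: id_def[symmetric])

lemma limitin_oplus:
  assumes "limitin X f a F" "limitin X g b F"
  shows "limitin X (\<lambda>k. f k \<oplus> g k) (a \<oplus> b) F"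
proof -
  have "limitin (prod_topology X X) (\<lambda>k. (f k, g k)) (a, b) F"
    using assms by (simp add: limitin_pairwise o_def)
  from continuous_map_limit[OF continuous_oplus this] show ?thesis by (simp add: o_def)
qed

lemma limitin_neg: "limitin X f a F \<Longrightarrow> limitin X (\<lambda>k. \<ominus> (f k)) (\<ominus> a) F"
  using continuous_map_limit[OF continuous_neg, of f a F] by (simp add: o_def)

lemma limitin_rsolve:
  "\<lbrakk>limitin X f a F; limitin X g b F\<rbrakk> \<Longrightarrow> limitin X (\<lambda>k. rsolve (f k) (g k)) (rsolve a b) F"
  unfolding rsolve_def by (intro limitin_oplus limitin_neg)

lemma limitin_const': "a \<in> topspace X \<Longrightarrow> limitin X (\<lambda>_. a) a F"
  by (simp add: limitin_const_iff limitin_def)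

lemma openin_ltrans: "\<lbrakk>x \<in> topspace X; openin X W\<rbrakk> \<Longrightarrow> openin X {y \<in> topspace X. x \<oplus> y \<in> W}"
  by (rule openin_continuous_map_preimage[OF continuous_map_ltrans])

lemma closedin_ltrans: "\<lbrakk>x \<in> topspace X; closedin X W\<rbrakk> \<Longrightarrow> closedin X {y \<in> topspace X. x \<oplus> y \<in> W}"
  by (rule closedin_continuous_map_preimage[OF continuous_map_ltrans])

lemma open_nbhd_triple:
  assumes t: "continuous_map (prod_topology X (prod_topology X X)) X t"
    and W: "openin X W" "t (\<zero>, \<zero>, \<zero>) \<in> W"
  shows "\<exists>V. openin X V \<and> \<zero> \<in> V \<and> (\<forall>u\<in>V. \<forall>v\<in>V. \<forall>w\<in>V. t (u, v, w) \<in> W)"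
proof -
  let ?P = "{p \<in> topspace (prod_topology X (prod_topology X X)). t p \<in> W}"
  have "openin (prod_topology X (prod_topology X X)) ?P"
    by (rule openin_continuous_map_preimage[OF t W(1)])
  moreover have "(\<zero>, \<zero>, \<zero>) \<in> ?P" using W zero_closed by simp
  ultimately have "\<exists>A B. openin X A \<and> openin (prod_topology X X) B \<and>
      \<zero> \<in> A \<and> (\<zero>, \<zero>) \<in> B \<and> A \<times> B \<subseteq> ?P"
    unfolding openin_prod_topology_alt[of X "prod_topology X X" ?P] by fast
  then obtain A B where A: "openin X A" "\<zero> \<in> A"
    and B: "openin (prod_topology X X) B" "(\<zero>, \<zero>) \<in> B" and AB: "A \<times> B \<subseteq> ?P"
    by (elim exE conjE)
  have "\<exists>C D. openin X C \<and> openin X D \<and> \<zero> \<in> C \<and> \<zero> \<in> D \<and> C \<times> D \<subseteq> B"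
    using B unfolding openin_prod_topology_alt[of X X B] by fast
  then obtain C D where CD: "openin X C" "openin X D" "\<zero> \<in> C" "\<zero> \<in> D" "C \<times> D \<subseteq> B"
    by (elim exE conjE)
  show ?thesis
  proof (intro exI[of _ "A \<inter> C \<inter> D"] conjI ballI)
    show "openin X (A \<inter> C \<inter> D)" using A CD by (intro openin_Int)
    show "\<zero> \<in> A \<inter> C \<inter> D" using A CD by simp
    fix u v w assume "u \<in> A \<inter> C \<inter> D" "v \<in> A \<inter> C \<inter> D" "w \<in> A \<inter> C \<inter> D"
    then have "(u, v, w) \<in> A \<times> B" using CD(5) by blast
    then show "t (u, v, w) \<in> W" using AB by blast
  qed
qed

lemma open_nbhd_pair:
  assumes t: "continuous_map (prod_topology X X) X t"
    and W: "openin X W" "t (\<zero>, \<zero>) \<in> W"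
  shows "\<exists>V. openin X V \<and> \<zero> \<in> V \<and> (\<forall>u\<in>V. \<forall>v\<in>V. t (u, v) \<in> W)"
proof -
  have "continuous_map (prod_topology X (prod_topology X X)) X (t \<circ> snd)"
    using continuous_map_compose[OF continuous_map_snd t] .
  from open_nbhd_triple[OF this W(1)] W(2) obtain V where
    "openin X V" "\<zero> \<in> V" "\<forall>u\<in>V. \<forall>v\<in>V. \<forall>w\<in>V. t (v, w) \<in> W" by auto
  then show ?thesis by blast
qed

text \<open>If \<open>y\<close> is in the closure of \<open>V\<close>, the neighbourhood
  \<open>y \<oplus> V\<close> of \<open>y\<close> meets \<open>V\<close> in some
  \<open>z = y \<oplus> v\<close>. Then \<open>y = rsolve z v\<close>, which lies in
  \<open>W\<close> once \<open>V\<close> is chosen by continuity of \<open>rsolve\<close> at the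
  identity.\<close>

lemma closed_nbhd_zero:
  assumes "openin X W" "\<zero> \<in> W"
  shows "\<exists>V. openin X V \<and> \<zero> \<in> V \<and> X closure_of V \<subseteq> W"
proof -
  have "continuous_map (prod_topology X X) X (\<lambda>p. rsolve (fst p) (snd p))"
    by (intro continuous_map_rsolve continuous_map_fst continuous_map_snd)
  from open_nbhd_pair[OF this assms(1)] obtain V where
    V: "openin X V" "\<zero> \<in> V" "\<And>u v. \<lbrakk>u \<in> V; v \<in> V\<rbrakk> \<Longrightarrow> rsolve u v \<in> W"
    using assms(2) rsolve_zero[OF zero_closed] by auto
  have "y \<in> W" if ycl: "y \<in> X closure_of V" for y
  proof -
    have y: "y \<in> topspace X" using that in_closure_of by metis
    define N where "N = {z \<in> topspace X. \<ominus> y \<oplus> z \<in> V}"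
    have "openin X N"
      unfolding N_def using neg_closed[OF y] V(1) by (rule openin_ltrans)
    moreover have "y \<in> N" using y V(2) by (simp add: N_def)
    ultimately have "\<exists>z. z \<in> V \<and> z \<in> N"
      using ycl in_closure_of[of y X V] by simp
    then obtain z where z: "z \<in> V" "z \<in> topspace X" "\<ominus> y \<oplus> z \<in> V"
      by (auto simp: N_def)
    have "rsolve z (\<ominus> y \<oplus> z) \<in> W" using V(3)[OF z(1,3)] .
    moreover have "rsolve (y \<oplus> (\<ominus> y \<oplus> z)) (\<ominus> y \<oplus> z) = y"
      using y z by (intro rsolve_oplus) (auto simp: closed_ops)
    ultimately show ?thesis using y z by simp
  qed
  then show ?thesis using V(1,2) by blast
qed

lemma regular_space_gyro: "regular_space X"
proof -
  have "\<exists>V C. openin X V \<and> closedin X C \<and> x \<in> V \<and> V \<subseteq> C \<and> C \<subseteq> W"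
    if W: "openin X W" "x \<in> W" for W x
  proof -
    have x: "x \<in> topspace X" using W openin_subset by blast
    have "openin X {y \<in> topspace X. x \<oplus> y \<in> W}" using x W by (intro openin_ltrans)
    then obtain V where V: "openin X V" "\<zero> \<in> V" "X closure_of V \<subseteq> {y \<in> topspace X. x \<oplus> y \<in> W}"
      using closed_nbhd_zero[of "{y \<in> topspace X. x \<oplus> y \<in> W}"] x W zero_closed by auto
    define V' where "V' = {z \<in> topspace X. \<ominus> x \<oplus> z \<in> V}"
    define C where "C = {z \<in> topspace X. \<ominus> x \<oplus> z \<in> X closure_of V}"
    have "openin X V'" "closedin X C" unfolding V'_def C_def
      using x V by (auto intro!: openin_ltrans closedin_ltrans simp: closed_ops)
    moreover have "x \<in> V'" using x V by (simp add: V'_def)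
    moreover have "V' \<subseteq> C" using closure_of_subset[OF openin_subset[OF V(1)]]
      by (auto simp: V'_def C_def)
    moreover have "C \<subseteq> W"
    proof
      fix z assume "z \<in> C"
      then have "z \<in> topspace X" "x \<oplus> (\<ominus> x \<oplus> z) \<in> W" using V(3) by (auto simp: C_def)
      then show "z \<in> W" using x by simp
    qed
    ultimately show ?thesis by blast
  qed
  then have "neighbourhood_base_of (closedin X) X"
    unfolding neighbourhood_base_of by blast
  then show ?thesis using neighbourhood_base_of_closedin by blast
qed

end

section \<open>Gyrogroups with an \<open>\<omega>\<^sup>\<omega>\<close>-base\<close>

locale omega_gyrogroup =
  topological_gyrogroup X oplus zero neg gyr
  for X :: "'a topology"
    and oplus :: "'a \<Rightarrow> 'a \<Rightarrow> 'a" (infixl \<open>\<oplus>\<close> 65)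
    and zero :: 'a (\<open>\<zero>\<close>)
    and neg :: "'a \<Rightarrow> 'a" (\<open>\<ominus> _\<close> [81] 80)
    and gyr :: "'a \<Rightarrow> 'a \<Rightarrow> 'a \<Rightarrow> 'a" +
  fixes U :: "(nat \<Rightarrow> nat) \<Rightarrow> 'a set"
  assumes Hausdorff: "Hausdorff_space X"
    and U_closed: "closedin X (U \<alpha>)"
    and U_nbhd: "\<exists>V. openin X V \<and> \<zero> \<in> V \<and> V \<subseteq> U \<alpha>"
    and U_base: "\<lbrakk>openin X W; \<zero> \<in> W\<rbrakk> \<Longrightarrow> \<exists>\<alpha>. U \<alpha> \<subseteq> W"
    and U_antimono: "\<alpha> \<le> \<beta> \<Longrightarrow> U \<beta> \<subseteq> U \<alpha>"

lemma (in topological_gyrogroup) ex_omega_gyrogroup: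
  assumes "Hausdorff_space X" "has_omega_omega_base X"
  obtains U where "omega_gyrogroup X oplus zero neg gyr U"
proof -
  from assms(2)[unfolded has_omega_omega_base_def, THEN bspec, OF zero_closed]
  obtain U :: "(nat \<Rightarrow> nat) \<Rightarrow> 'a set" where *: "(\<forall>\<alpha>. U \<alpha> \<subseteq> topspace X \<and> (\<exists>V. openin X V \<and> \<zero> \<in> V \<and> V \<subseteq> U \<alpha>)) \<and>
    (\<forall>W. openin X W \<and> \<zero> \<in> W \<longrightarrow> (\<exists>\<alpha>. U \<alpha> \<subseteq> W)) \<and>
    (\<forall>\<alpha> \<beta>. \<alpha> \<le> \<beta> \<longrightarrow> U \<beta> \<subseteq> U \<alpha>)" ..
  note U = *[THEN conjunct1] *[THEN conjunct2, THEN conjunct1] *[THEN conjunct2, THEN conjunct2]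
  \<comment> \<open>Closures still form a base by \<open>closed_nbhd_zero\<close>. Closed members
    make the sets \<open>D s\<close> closed and keep limits of sequences inside
    \<open>U \<alpha>\<close>.\<close>
  have "omega_gyrogroup X oplus zero neg gyr (\<lambda>\<alpha>. X closure_of (U \<alpha>))"
  proof (unfold_locales, goal_cases)
    case (3 \<alpha>)
    have "U \<alpha> \<subseteq> X closure_of U \<alpha>" using U(1) by (intro closure_of_subset) blast
    then show ?case using U(1) by (meson order_trans)
  next
    case (4 W)
    obtain V where V: "openin X V" "\<zero> \<in> V" "X closure_of V \<subseteq> W"
      using closed_nbhd_zero[OF 4] by (elim exE conjE)
    then obtain \<alpha> where "U \<alpha> \<subseteq> V" using U(2) by blast
    then have "X closure_of U \<alpha> \<subseteq> X closure_of V" by (rule closure_of_mono)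
    then have "X closure_of U \<alpha> \<subseteq> W" using V(3) by (rule order_trans)
    then show ?case by (rule exI[of _ \<alpha>])
  next
    case (5 \<alpha> \<beta>)
    then show ?case using U(3) by (simp add: closure_of_mono)
  qed (use assms in auto)
  then show thesis by (rule that)
qed

context omega_gyrogroup
begin

lemma U_subset: "U \<alpha> \<subseteq> topspace X"
  using U_closed closedin_subset by blast

lemma zero_in_U: "\<zero> \<in> U \<alpha>"
  using U_nbhd[of \<alpha>] by blast

lemma U_pair:
  assumes "continuous_map (prod_topology X X) X t" "openin X W" "t (\<zero>, \<zero>) \<in> W"
  shows "\<exists>\<alpha>. \<forall>u\<in>U \<alpha>. \<forall>v\<in>U \<alpha>. t (u, v) \<in> W"
proof -
  obtain V where V: "openin X V" "\<zero> \<in> V" "\<forall>u\<in>V. \<forall>v\<in>V. t (u, v) \<in> W"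
    using open_nbhd_pair[OF assms] by (elim exE conjE)
  obtain \<alpha> where "U \<alpha> \<subseteq> V" using U_base[OF V(1,2)] by (elim exE)
  then show ?thesis using V(3) by (intro exI[of _ \<alpha>]) (simp add: subset_iff)
qed

lemma U_triple:
  assumes "continuous_map (prod_topology X (prod_topology X X)) X t" "openin X W" "t (\<zero>, \<zero>, \<zero>) \<in> W"
  shows "\<exists>\<alpha>. \<forall>u\<in>U \<alpha>. \<forall>v\<in>U \<alpha>. \<forall>w\<in>U \<alpha>. t (u, v, w) \<in> W"
proof -
  obtain V where V: "openin X V" "\<zero> \<in> V" "\<forall>u\<in>V. \<forall>v\<in>V. \<forall>w\<in>V. t (u, v, w) \<in> W"
    using open_nbhd_triple[OF assms] by (elim exE conjE)
  obtain \<alpha> where "U \<alpha> \<subseteq> V" using U_base[OF V(1,2)] by (elim exE)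
  then show ?thesis using V(3) by (intro exI[of _ \<alpha>]) (simp add: subset_iff)
qed

lemma U_base_at:
  assumes "openin X W" "x \<in> W"
  shows "\<exists>\<alpha>. \<forall>u\<in>U \<alpha>. x \<oplus> u \<in> W"
proof -
  have x: "x \<in> topspace X" using assms openin_subset by blast
  have "openin X {y \<in> topspace X. x \<oplus> y \<in> W}" using x assms(1) by (rule openin_ltrans)
  moreover have "\<zero> \<in> {y \<in> topspace X. x \<oplus> y \<in> W}" using x assms(2) zero_closed by simp
  ultimately obtain \<alpha> where "U \<alpha> \<subseteq> {y \<in> topspace X. x \<oplus> y \<in> W}" using U_base by meson
  then show ?thesis by (intro exI[of _ \<alpha>]) (simp add: subset_iff)
qed

text \<open>Here \<open>z\<close> is fixed while the centre \<open>x\<close> varies. As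
  \<open>x = rsolve z u\<close>, the point \<open>x \<oplus> v\<close> is a continuous function of
  \<open>(u, v)\<close> with value \<open>z\<close> at \<open>(\<zero>, \<zero>)\<close>, so one
  \<open>\<alpha>\<close> serves all centres.\<close>

lemma U_base_close:
  assumes "openin X W" "z \<in> W"
  shows "\<exists>\<alpha>. \<forall>u\<in>U \<alpha>. \<forall>v\<in>U \<alpha>. \<forall>x\<in>topspace X. x \<oplus> u = z \<longrightarrow> x \<oplus> v \<in> W"
proof -
  have z: "z \<in> topspace X" using assms openin_subset by blast
  have "continuous_map (prod_topology X X) X (\<lambda>p. rsolve z (fst p) \<oplus> snd p)"
    using z by (intro continuous_map_gyro continuous_map_fst continuous_map_snd) auto
  moreover have "rsolve z (fst (\<zero>, \<zero>)) \<oplus> snd (\<zero>, \<zero>) \<in> W"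
    using z assms(2) by (simp add: rsolve_zero)
  ultimately obtain \<alpha> where \<alpha>: "\<forall>u\<in>U \<alpha>. \<forall>v\<in>U \<alpha>. rsolve z (fst (u, v)) \<oplus> snd (u, v) \<in> W"
    using U_pair[OF _ assms(1)] by meson
  show ?thesis
  proof (intro exI[of _ \<alpha>] ballI impI)
    fix u v x assume h: "u \<in> U \<alpha>" "v \<in> U \<alpha>" "x \<in> topspace X" "x \<oplus> u = z"
    have "rsolve (x \<oplus> u) u = x" using h U_subset by (intro rsolve_oplus) auto
    then show "x \<oplus> v \<in> W" using \<alpha> h by fastforce
  qed
qed

section \<open>The countable family \<open>D s\<close> attached to the base\<close>

definition D :: "nat list \<Rightarrow> 'a set" where
  "D s = \<Inter>{U \<beta> | \<beta>. \<forall>i<length s. \<beta> i = s ! i}"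

definition pre :: "(nat \<Rightarrow> nat) \<Rightarrow> nat \<Rightarrow> nat list" where
  "pre \<alpha> n = map \<alpha> [0..<n]"

lemma in_D_pre: "x \<in> D (pre \<alpha> n) \<longleftrightarrow> (\<forall>\<beta>. (\<forall>i<n. \<beta> i = \<alpha> i) \<longrightarrow> x \<in> U \<beta>)"
  unfolding D_def pre_def by auto

lemma D_pre_subset: "D (pre \<alpha> n) \<subseteq> U \<alpha>"
  by (auto simp: in_D_pre)

lemma D_pre_mono: "m \<le> n \<Longrightarrow> D (pre \<alpha> m) \<subseteq> D (pre \<alpha> n)"
  by (auto simp: in_D_pre)

lemma D_closed: "closedin X (D s)"
proof -
  have "(\<lambda>i. if i < length s then s ! i else 0) \<in> {\<beta>. \<forall>i<length s. \<beta> i = s ! i}" by simp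
  then have "{U \<beta> | \<beta>. \<forall>i<length s. \<beta> i = s ! i} \<noteq> {}" by blast
  then show ?thesis unfolding D_def by (rule closedin_Inter) (use U_closed in blast)
qed

text \<open>
  The key property of an \<open>\<omega>\<^sup>\<omega>\<close>-base: countably many witnesses \<open>\<beta>\<close>, the n-th one agreeing with
  \<open>\<alpha>\<close> below \<open>n\<close>, have a pointwise upper bound \<open>\<gamma>\<close>.
\<close>

lemma avoid_D:
  assumes fin: "\<And>n. finite (A n)" and disj: "\<And>n x. x \<in> A n \<Longrightarrow> x \<notin> D (pre \<alpha> n)"
  shows "\<exists>\<gamma>. \<forall>n. \<forall>x\<in>A n. x \<notin> U \<gamma>"
proof -
  have "\<forall>n. \<forall>x\<in>A n. \<exists>\<beta>. (\<forall>i<n. \<beta> i = \<alpha> i) \<and> x \<notin> U \<beta>"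
    using disj by (simp add: in_D_pre)
  then have "\<exists>\<beta>. \<forall>n. \<forall>x\<in>A n. (\<forall>i<n. \<beta> n x i = \<alpha> i) \<and> x \<notin> U (\<beta> n x)"
    by (metis (no_types))
  then obtain \<beta> where \<beta>: "\<And>n x i. \<lbrakk>x \<in> A n; i < n\<rbrakk> \<Longrightarrow> \<beta> n x i = \<alpha> i"
    "\<And>n x. x \<in> A n \<Longrightarrow> x \<notin> U (\<beta> n x)" by auto
  \<comment> \<open>Only the finitely many witnesses with \<open>n \<le> i\<close> can have an
    \<open>i\<close>-th value other than \<open>\<alpha> i\<close>, so the maximum exists.\<close>
  define T where "T i = insert (\<alpha> i) (\<Union>n\<le>i. (\<lambda>x. \<beta> n x i) ` A n)" for i
  define \<gamma> where "\<gamma> i = Max (T i)" for i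
  have T: "finite (T i)" for i unfolding T_def using fin by auto
  have le: "\<beta> n x \<le> \<gamma>" if x: "x \<in> A n" for n x
  proof (rule le_funI)
    fix i
    have "\<beta> n x i \<in> T i"
    proof (cases "n \<le> i")
      case True
      then show ?thesis using x unfolding T_def by blast
    next
      case False
      then show ?thesis using \<beta>(1)[OF x, of i] by (simp add: T_def)
    qed
    then show "\<beta> n x i \<le> \<gamma> i" unfolding \<gamma>_def using T by (intro Max_ge)
  qed
  show ?thesis
  proof (intro exI[of _ \<gamma>] allI ballI)
    fix n x assume x: "x \<in> A n"
    show "x \<notin> U \<gamma>" using \<beta>(2)[OF x] U_antimono[OF le[OF x]] by blast
  qed
qed

lemma avoid_D_sequence:
  assumes "\<And>n. s n \<notin> D (pre \<alpha> n)"
  shows "\<exists>\<gamma>. \<forall>n. s n \<notin> U \<gamma>"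
proof -
  have "\<exists>\<gamma>. \<forall>n. \<forall>x\<in>{s n}. x \<notin> U \<gamma>"
    by (rule avoid_D[of "\<lambda>n. {s n}" \<alpha>]) (use assms in auto)
  then show ?thesis by simp
qed

text \<open>Terms escaping from \<open>D (pre \<alpha> n)\<close> arbitrarily late, for every
  \<open>n\<close>, would all avoid a single \<open>U \<gamma>\<close>.\<close>

lemma eventually_in_D:
  assumes "limitin X s \<zero> sequentially"
  shows "\<exists>n. \<forall>\<^sub>F k in sequentially. s k \<in> D (pre \<alpha> n)"
proof (rule ccontr)
  assume "\<not> ?thesis"
  then have "\<forall>n. \<exists>k\<ge>n. s k \<notin> D (pre \<alpha> n)"
    unfolding eventually_sequentially by blast
  then obtain k where k: "\<And>n. k n \<ge> n" "\<And>n. s (k n) \<notin> D (pre \<alpha> n)" by metis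
  obtain \<gamma> where \<gamma>: "\<forall>n. s (k n) \<notin> U \<gamma>" using avoid_D_sequence[of "\<lambda>n. s (k n)" \<alpha>] k(2) by blast
  obtain V where V: "openin X V" "\<zero> \<in> V" "V \<subseteq> U \<gamma>" using U_nbhd by meson
  then obtain N where "\<forall>n\<ge>N. s n \<in> V" using assms by (meson limitin_sequentially)
  then have "s (k N) \<in> V" using k(1) by blast
  then show False using \<gamma> V(3) by blast
qed

section \<open>Total boundedness and countable networks\<close>

definition sep :: "'a set \<Rightarrow> 'a list \<Rightarrow> bool" where
  "sep S l \<longleftrightarrow> (\<forall>i j. i < j \<and> j < length l \<longrightarrow> \<ominus> (l ! i) \<oplus> l ! j \<notin> S)"

text \<open>A uniform bound on separated lists rather than the absence of infinite ones:
  \<open>avoid_D\<close> handles finite sets only, and it turns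
  \<open>D (pre \<alpha> n)\<close>-separated lists longer than \<open>n\<close> into lists
  separated by one common \<open>U \<gamma>\<close>.\<close>

definition tot_bounded :: "'a set \<Rightarrow> bool" where
  "tot_bounded Q \<longleftrightarrow> (\<forall>\<gamma>. \<exists>m. \<forall>l. set l \<subseteq> Q \<and> sep (U \<gamma>) l \<longrightarrow> length l \<le> m)"

text \<open>For suitable \<open>s\<close> a longest \<open>D s\<close>-separated list is a finite
  net for \<open>Q\<close>. The network consists of the translates \<open>x \<oplus> D s\<close>
  with \<open>x\<close> in this net; it is countable since there are countably many
  \<open>s\<close>.\<close>

lemma tot_bounded_imp_countable_network:
  assumes Q: "Q \<subseteq> topspace X" "tot_bounded Q"
  shows "countable_network X Q"
proof -
  have ex_bound: "\<exists>n m. \<forall>l. set l \<subseteq> Q \<and> sep (D (pre \<alpha> n)) l \<longrightarrow> length l \<le> m" for \<alpha>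
  proof (rule ccontr)
    assume "\<not> ?thesis"
    then have "\<forall>n. \<exists>l. set l \<subseteq> Q \<and> sep (D (pre \<alpha> n)) l \<and> length l > n"
      using not_le by blast
    from choice[OF this]
    obtain l where *: "\<forall>n. set (l n) \<subseteq> Q \<and> sep (D (pre \<alpha> n)) (l n) \<and> length (l n) > n" ..
    then have l: "\<And>n. set (l n) \<subseteq> Q" "\<And>n. sep (D (pre \<alpha> n)) (l n)" "\<And>n. length (l n) > n"
      by simp_all
    define A where "A n = (\<lambda>(i, j). \<ominus> (l n ! i) \<oplus> l n ! j) ` {(i, j). i < j \<and> j < length (l n)}" for n
    have "finite (A n)" for n
      unfolding A_def
      by (rule finite_imageI, rule finite_subset[of _ "{..<length (l n)} \<times> {..<length (l n)}"]) auto
    moreover have "x \<notin> D (pre \<alpha> n)" if "x \<in> A n" for n x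
      using that l(2)[of n] unfolding A_def sep_def by auto
    ultimately obtain \<gamma> where \<gamma>: "\<forall>n. \<forall>x\<in>A n. x \<notin> U \<gamma>" using avoid_D[of A \<alpha>] by blast
    obtain m where m: "\<And>l. set l \<subseteq> Q \<and> sep (U \<gamma>) l \<Longrightarrow> length l \<le> m"
      using Q(2) unfolding tot_bounded_def by meson
    have "sep (U \<gamma>) (l m)"
      unfolding sep_def
    proof (intro allI impI)
      fix i j assume ij: "i < j \<and> j < length (l m)"
      have "\<ominus> (l m ! i) \<oplus> l m ! j \<in> A m"
        unfolding A_def by (rule image_eqI[of _ _ "(i, j)"]) (use ij in auto)
      then show "\<ominus> (l m ! i) \<oplus> l m ! j \<notin> U \<gamma>" using \<gamma> by blast
    qed
    then show False using m[of "l m"] l(1)[of m] l(3)[of m] by simp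
  qed
  \<comment> \<open>By \<open>ex_bound\<close> every \<open>\<alpha>\<close> has a prefix in
    \<open>S\<close>, and this is enough because \<open>D\<close> of a prefix lies in
    \<open>U \<alpha>\<close>.\<close>
  define S where "S = {s. \<exists>m. \<forall>l. set l \<subseteq> Q \<and> sep (D s) l \<longrightarrow> length l \<le> m}"
  have "\<forall>s\<in>S. \<exists>l. set l \<subseteq> Q \<and> sep (D s) l \<and> (\<forall>l'. set l' \<subseteq> Q \<and> sep (D s) l' \<longrightarrow> length l' \<le> length l)"
  proof
    fix s assume "s \<in> S"
    then obtain m where m: "\<forall>l. set l \<subseteq> Q \<and> sep (D s) l \<longrightarrow> length l \<le> m" by (auto simp: S_def)
    have "set [] \<subseteq> Q \<and> sep (D s) []" by (simp add: sep_def)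
    moreover have "\<forall>l. set l \<subseteq> Q \<and> sep (D s) l \<longrightarrow> length l < Suc m"
      using m by (simp add: less_Suc_eq_le)
    ultimately have "\<exists>l. (set l \<subseteq> Q \<and> sep (D s) l) \<and>
        (\<forall>l'. set l' \<subseteq> Q \<and> sep (D s) l' \<longrightarrow> length l' \<le> length l)"
      by (rule ex_has_greatest_nat)
    then
    show "\<exists>l. set l \<subseteq> Q \<and> sep (D s) l \<and> (\<forall>l'. set l' \<subseteq> Q \<and> sep (D s) l' \<longrightarrow> length l' \<le> length l)"
      by (simp add: conj_assoc)
  qed
  from bchoice[OF this] obtain L where *: "\<forall>s\<in>S. set (L s) \<subseteq> Q \<and> sep (D s) (L s) \<and>
      (\<forall>l'. set l' \<subseteq> Q \<and> sep (D s) l' \<longrightarrow> length l' \<le> length (L s))" ..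
  then have L: "\<And>s. s \<in> S \<Longrightarrow> set (L s) \<subseteq> Q" "\<And>s. s \<in> S \<Longrightarrow> sep (D s) (L s)"
    "\<And>s l. \<lbrakk>s \<in> S; set l \<subseteq> Q; sep (D s) l\<rbrakk> \<Longrightarrow> length l \<le> length (L s)" by simp_all
  define \<N> where "\<N> = (\<Union>s\<in>S. (\<lambda>x. (\<lambda>y. x \<oplus> y) ` D s) ` set (L s))"
  have "countable \<N>" unfolding \<N>_def by (intro countable_UN countable_image) (auto intro: countable_finite)
  moreover have "\<exists>N\<in>\<N>. z \<in> N \<and> N \<subseteq> W" if z: "z \<in> Q" and W: "openin X W \<and> z \<in> W" for z W
  proof -
    obtain \<alpha> where \<alpha>: "\<forall>u\<in>U \<alpha>. \<forall>v\<in>U \<alpha>. \<forall>x\<in>topspace X. x \<oplus> u = z \<longrightarrow> x \<oplus> v \<in> W"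
      using U_base_close[OF conjunct1[OF W] conjunct2[OF W]] by (elim exE)
    obtain n where n: "pre \<alpha> n \<in> S" using ex_bound[of \<alpha>] by (auto simp: S_def)
    define s where "s = pre \<alpha> n"
    have s: "s \<in> S" "D s \<subseteq> U \<alpha>" using n D_pre_subset by (auto simp: s_def)
    \<comment> \<open>By maximality \<open>z\<close> cannot be appended. As \<open>L s\<close> is
      separated, the offending pair ends in \<open>z\<close>, and the order built into
      \<open>sep\<close> gives the difference in the form
      \<open>\<ominus> x \<oplus> z\<close>.\<close>
    have "\<not> sep (D s) (L s @ [z])"
    proof
      assume "sep (D s) (L s @ [z])"
      then have "length (L s @ [z]) \<le> length (L s)"
        using L(1)[OF s(1)] z by (intro L(3)[OF s(1)]) auto
      then show False by simp
    qed
    then obtain i j where ij: "i < j" "j < Suc (length (L s))"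
      "\<ominus> ((L s @ [z]) ! i) \<oplus> (L s @ [z]) ! j \<in> D s" unfolding sep_def by auto
    have "j = length (L s)"
    proof (rule ccontr)
      assume "j \<noteq> length (L s)"
      then have "j < length (L s)" using ij by simp
      then show False using ij L(2)[OF s(1)] unfolding sep_def by (auto simp: nth_append)
    qed
    then have i: "i < length (L s)" "\<ominus> (L s ! i) \<oplus> z \<in> D s" using ij by (auto simp: nth_append)
    define x where "x = L s ! i"
    have xL: "x \<in> set (L s)" using i(1) by (simp add: x_def)
    have x: "x \<in> set (L s)" "\<ominus> x \<oplus> z \<in> D s" "x \<in> topspace X" "z \<in> topspace X"
      using xL i L(1)[OF s(1)] Q(1) z by (auto simp flip: x_def)
    have xz: "x \<oplus> (\<ominus> x \<oplus> z) = z" using x by simp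
    show ?thesis
    proof (intro bexI[of _ "(\<lambda>y. x \<oplus> y) ` D s"] conjI)
      show "z \<in> (\<lambda>y. x \<oplus> y) ` D s" using x(2) xz by (intro image_eqI[of _ _ "\<ominus> x \<oplus> z"]) auto
      show "(\<lambda>y. x \<oplus> y) ` D s \<subseteq> W"
      proof
        fix w assume "w \<in> (\<lambda>y. x \<oplus> y) ` D s"
        then obtain v where v: "v \<in> D s" "w = x \<oplus> v" by blast
        have "\<ominus> x \<oplus> z \<in> U \<alpha>" "v \<in> U \<alpha>" using s(2) x(2) v(1) by auto
        then show "w \<in> W" unfolding v(2) using \<alpha> x(3) xz by simp
      qed
      show "(\<lambda>y. x \<oplus> y) ` D s \<in> \<N>" 
        unfolding \<N>_def using s(1) x(1) by (intro UN_I[OF s(1)]) (rule imageI[OF x(1)])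
    qed
  qed
  ultimately show ?thesis unfolding countable_network_def by blast
qed

end

context topological_gyrogroup
begin

lemma small_nbhd:
  assumes x: "x \<in> topspace X" and V: "openin X V" "\<zero> \<in> V"
  shows "\<exists>N. openin X N \<and> x \<in> N \<and> (\<forall>y\<in>N. \<forall>z\<in>N. \<ominus> y \<oplus> z \<in> V)"
proof -
  define P where "P = {p \<in> topspace (prod_topology X X). \<ominus> (fst p) \<oplus> snd p \<in> V}"
  have "continuous_map (prod_topology X X) X (\<lambda>p. \<ominus> (fst p) \<oplus> snd p)"
    by (intro continuous_map_gyro continuous_map_fst continuous_map_snd)
  from openin_continuous_map_preimage[OF this V(1)]
  have "openin (prod_topology X X) P" unfolding P_def .
  moreover have "(x, x) \<in> P" using x V(2) by (simp add: P_def)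
  ultimately have "\<exists>A B. openin X A \<and> openin X B \<and> x \<in> A \<and> x \<in> B \<and> A \<times> B \<subseteq> P"
    using openin_prod_topology_alt[of X X P] by fast
  then obtain A B where AB: "openin X A" "openin X B" "x \<in> A" "x \<in> B" "A \<times> B \<subseteq> P"
    by (elim exE conjE)
  show ?thesis
  proof (intro exI[of _ "A \<inter> B"] conjI ballI)
    show "openin X (A \<inter> B)" using AB(1,2) by (rule openin_Int)
    show "x \<in> A \<inter> B" using AB by simp
    fix y z assume "y \<in> A \<inter> B" "z \<in> A \<inter> B"
    then have "(y, z) \<in> P" using AB(5) by auto
    then show "\<ominus> y \<oplus> z \<in> V" by (simp add: P_def)
  qed
qed

end

definition seq_compactin :: "'a topology \<Rightarrow> 'a set \<Rightarrow> bool" where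
  "seq_compactin X Q \<longleftrightarrow> Q \<subseteq> topspace X \<and>
    (\<forall>s. range s \<subseteq> Q \<longrightarrow>
      (\<exists>r x. strict_mono (r :: nat \<Rightarrow> nat) \<and> x \<in> Q \<and> limitin X (s \<circ> r) x sequentially))"

context omega_gyrogroup
begin

text \<open>Pigeonhole: in a finite cover by sets with small left differences, two entries of a long
  list share a set.\<close>

lemma compactin_imp_tot_bounded:
  assumes K: "compactin X K"
  shows "tot_bounded K"
  unfolding tot_bounded_def
proof
  fix \<gamma>
  obtain V where V: "openin X V" "\<zero> \<in> V" "V \<subseteq> U \<gamma>" using U_nbhd[of \<gamma>] by (elim exE conjE)
  define \<O> where "\<O> = {N. openin X N \<and> (\<forall>y\<in>N. \<forall>z\<in>N. \<ominus> y \<oplus> z \<in> V)}"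
  have "K \<subseteq> \<Union>\<O>"
  proof
    fix x assume "x \<in> K"
    then have "x \<in> topspace X" using K compactin_subset_topspace by blast
    from small_nbhd[OF this V(1,2)]
    obtain N where "openin X N \<and> x \<in> N \<and> (\<forall>y\<in>N. \<forall>z\<in>N. \<ominus> y \<oplus> z \<in> V)" ..
    then have "N \<in> \<O>" "x \<in> N" by (simp_all add: \<O>_def)
    then show "x \<in> \<Union>\<O>" by blast
  qed
  then have "\<exists>\<F>. finite \<F> \<and> \<F> \<subseteq> \<O> \<and> K \<subseteq> \<Union>\<F>"
    using K by (intro compactinD) (auto simp: \<O>_def)
  then obtain \<F> where F: "finite \<F>" "\<F> \<subseteq> \<O>" "K \<subseteq> \<Union>\<F>" by (elim exE conjE)
  have "length l \<le> card \<F>" if l: "set l \<subseteq> K" "sep (U \<gamma>) l" for l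
  proof (rule ccontr)
    assume long: "\<not> length l \<le> card \<F>"
    have "\<forall>i\<in>{..<length l}. \<exists>N. N \<in> \<F> \<and> l ! i \<in> N"
    proof
      fix i assume "i \<in> {..<length l}"
      then have "l ! i \<in> K" using l(1) by auto
      then show "\<exists>N. N \<in> \<F> \<and> l ! i \<in> N" using F(3) by blast
    qed
    from bchoice[OF this] obtain c where c: "\<forall>i\<in>{..<length l}. c i \<in> \<F> \<and> l ! i \<in> c i" ..
    have "\<not> inj_on c {..<length l}"
    proof
      assume "inj_on c {..<length l}"
      then have "card {..<length l} \<le> card \<F>"
        using c F(1) by (intro card_inj_on_le[of c]) auto
      then show False using long by simp
    qed
    then obtain i j where ij: "i < length l" "j < length l" "c i = c j" "i \<noteq> j"
      unfolding inj_on_def by auto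
    define a b where "a = min i j" and "b = max i j"
    have ab: "a < b" "b < length l" "c a = c b"
      using ij by (auto simp: a_def b_def min_def max_def)
    have "c a \<in> \<O>" "l ! a \<in> c a" "l ! b \<in> c a" using c ab F(2) by auto
    then have "\<ominus> (l ! a) \<oplus> l ! b \<in> V" by (simp add: \<O>_def)
    then show False using l(2) ab V(3) unfolding sep_def by blast
  qed
  then show "\<exists>m. \<forall>l. set l \<subseteq> K \<and> sep (U \<gamma>) l \<longrightarrow> length l \<le> m"
    by (intro exI[of _ "card \<F>"]) simp
qed

text \<open>Longer and longer separated lists are read columnwise. A diagonal subsequence makes
  every column \<open>j\<close> converge to some \<open>y j\<close>; these limits stay apart by
  \<open>V\<close>, so \<open>y\<close> has no convergent subsequence.\<close>

lemma seq_compactin_imp_tot_bounded: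
  assumes Q: "seq_compactin X Q"
  shows "tot_bounded Q"
proof (rule ccontr)
  assume "\<not> tot_bounded Q"
  then have "\<exists>\<gamma>. \<forall>n. \<exists>l. set l \<subseteq> Q \<and> sep (U \<gamma>) l \<and> n < length l"
    unfolding tot_bounded_def by (simp add: not_le)
  then obtain \<gamma> where "\<forall>n. \<exists>l. set l \<subseteq> Q \<and> sep (U \<gamma>) l \<and> n < length l" ..
  from choice[OF this] obtain l where "\<forall>n. set (l n) \<subseteq> Q \<and> sep (U \<gamma>) (l n) \<and> n < length (l n)" ..
  then have l: "\<And>n. set (l n) \<subseteq> Q" "\<And>n. sep (U \<gamma>) (l n)" "\<And>n. n < length (l n)"
    by simp_all
  have Q': "\<exists>r x. strict_mono (r :: nat \<Rightarrow> nat) \<and> x \<in> Q \<and> limitin X (s \<circ> r) x sequentially"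
    if "range s \<subseteq> Q" for s
    using Q that by (simp add: seq_compactin_def)
  \<comment> \<open>The first entry fills positions beyond the end of a list. As
    \<open>length (l n) > n\<close>, column \<open>j\<close> uses it only for
    \<open>n < j\<close>.\<close>
  define t where "t j n = (if j < length (l n) then l n ! j else l n ! 0)" for j n
  have tQ: "t j n \<in> Q" for j n
  proof -
    have "0 < length (l n)" using l(3)[of n] by linarith
    then have "t j n \<in> set (l n)" by (simp add: t_def)
    then show ?thesis using l(1) by blast
  qed
  define P where "P j r \<longleftrightarrow> (\<exists>y. y \<in> Q \<and> limitin X (t j \<circ> r) y sequentially)" for j :: nat and r :: "nat \<Rightarrow> nat"
  interpret subseqs P
  proof
    fix n and s :: "nat \<Rightarrow> nat"
    have "range (t n \<circ> s) \<subseteq> Q" using tQ by auto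
    from Q'[OF this] obtain r x where "strict_mono r" "x \<in> Q" "limitin X (t n \<circ> s \<circ> r) x sequentially"
      by (elim exE conjE)
    then show "\<exists>r'. strict_mono r' \<and> P n (s \<circ> r')"
      unfolding P_def by (intro exI[of _ r] conjI exI[of _ x]) (simp_all add: o_assoc)
  qed
  have "P j (diagseq \<circ> (+) (Suc j))" for j
  proof (rule diagseq_holds)
    fix r s :: "nat \<Rightarrow> nat" and n
    assume r: "strict_mono r" and "P n s"
    then obtain y where y: "y \<in> Q \<and> limitin X (t n \<circ> s) y sequentially" unfolding P_def by (elim exE)
    then have "limitin X (t n \<circ> s \<circ> r) y sequentially" by (intro limitin_subsequence[OF r]) simp
    then show "P n (s \<circ> r)" using y unfolding P_def by (intro exI[of _ y]) (simp add: o_assoc)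
  qed
  then have "\<forall>j. \<exists>y. y \<in> Q \<and> limitin X (t j \<circ> (diagseq \<circ> (+) (Suc j))) y sequentially"
    unfolding P_def by blast
  from choice[OF this] obtain y where
    y: "\<forall>j. y j \<in> Q \<and> limitin X (t j \<circ> (diagseq \<circ> (+) (Suc j))) (y j) sequentially" ..
  have lim: "limitin X (\<lambda>k. t j (diagseq k)) (y j) sequentially" for j
  proof (rule limitin_sequentially_offset_rev)
    show "limitin X (\<lambda>i. t j (diagseq (i + Suc j))) (y j) sequentially"
      using y[THEN spec, of j] by (simp add: o_def add.commute)
  qed
  obtain V where V: "openin X V" "\<zero> \<in> V" "V \<subseteq> U \<gamma>" using U_nbhd[of \<gamma>] by (elim exE conjE)
  \<comment> \<open>Openness of \<open>V\<close> matters: a limit difference in \<open>V\<close>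
    would force differences of list entries into \<open>V\<close> and hence into
    \<open>U \<gamma>\<close>.\<close>
  have far: "\<ominus> (y i) \<oplus> y j \<notin> V" if ij: "i < j" for i j
  proof
    assume yV: "\<ominus> (y i) \<oplus> y j \<in> V"
    have "limitin X (\<lambda>k. \<ominus> (t i (diagseq k)) \<oplus> t j (diagseq k)) (\<ominus> (y i) \<oplus> y j) sequentially"
      by (intro limitin_oplus limitin_neg lim)
    then have "\<forall>\<^sub>F k in sequentially. \<ominus> (t i (diagseq k)) \<oplus> t j (diagseq k) \<in> V"
      using V(1) yV by (simp add: limitin_def)
    then obtain N where N: "\<And>k. k \<ge> N \<Longrightarrow> \<ominus> (t i (diagseq k)) \<oplus> t j (diagseq k) \<in> V"
      unfolding eventually_sequentially by auto
    define k where "k = max N j"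
    have "j \<le> diagseq k" using seq_suble[OF subseq_diagseq, of k] by (simp add: k_def)
    then have "j < length (l (diagseq k))" using l(3)[of "diagseq k"] by simp
    then have "\<ominus> (t i (diagseq k)) \<oplus> t j (diagseq k) \<notin> U \<gamma>"
      using l(2)[of "diagseq k"] ij unfolding sep_def t_def by simp
    moreover have "\<ominus> (t i (diagseq k)) \<oplus> t j (diagseq k) \<in> V" by (rule N) (simp add: k_def)
    ultimately show False using V(3) by blast
  qed
  have "range y \<subseteq> Q" using y by auto
  from Q'[OF this] obtain r x where r: "strict_mono r" "x \<in> Q" "limitin X (y \<circ> r) x sequentially"
    by (elim exE conjE)
  have x: "x \<in> topspace X" using r(2) Q unfolding seq_compactin_def by blast
  obtain N where N: "openin X N" "x \<in> N" "\<forall>y\<in>N. \<forall>z\<in>N. \<ominus> y \<oplus> z \<in> V"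
    using small_nbhd[OF x V(1,2)] by (elim exE conjE)
  have "\<forall>\<^sub>F k in sequentially. y (r k) \<in> N" using r(3) N by (simp add: limitin_def)
  then obtain k where "\<forall>i\<ge>k. y (r i) \<in> N" unfolding eventually_sequentially ..
  then have "\<ominus> (y (r k)) \<oplus> y (r (Suc k)) \<in> V" using N(3) by simp
  then show False using far[of "r k" "r (Suc k)"] r(1) by (simp add: strict_mono_def)
qed

lemma seq_compactin_imp_compactin:
  assumes "seq_compactin X Q"
  shows "compactin X Q"
proof (rule compactin_of_sequentially_compact)
  show "countable_network X Q"
    using assms seq_compactin_imp_tot_bounded tot_bounded_imp_countable_network
    by (simp add: seq_compactin_def)
qed (use assms in \<open>auto simp: seq_compactin_def\<close>)

lemma compactin_countable_network: "compactin X K \<Longrightarrow> countable_network X K"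
  by (rule tot_bounded_imp_countable_network[OF compactin_subset_topspace compactin_imp_tot_bounded])

lemma submetrizable_subtopology:
  assumes "countable_network X Q" "Q \<subseteq> topspace X"
  shows "submetrizable_space (subtopology X Q)"
proof (rule submetrizable_of_countable_network)
  show "regular_space (subtopology X Q)" using regular_space_gyro by (rule regular_space_subtopology)
  show "Hausdorff_space (subtopology X Q)" using Hausdorff by (rule Hausdorff_space_subtopology)
  show "countable_network (subtopology X Q) (topspace (subtopology X Q))"
    using countable_network_subtopology[OF assms(1), of Q] assms(2)
    by (simp add: topspace_subtopology Int_absorb1)
qed

lemma k_space_imp_sequential_space:
  assumes "k_space X"
  shows "sequential_space X"
  unfolding sequential_space_iff
proof (intro allI impI)
  fix A assume A: "seq_closedin X A"
  have AX: "A \<subseteq> topspace X" using A by (simp add: seq_closedin_def)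
  have "closedin (subtopology X K) (K \<inter> A)" if K: "compactin X K" for K
  proof (rule seq_closedin_compact_submetrizable)
    have KX: "K \<subseteq> topspace X" using K by (rule compactin_subset_topspace)
    show "submetrizable_space (subtopology X K)"
      using compactin_countable_network[OF K] KX by (rule submetrizable_subtopology)
    show "Hausdorff_space (subtopology X K)" using Hausdorff by (rule Hausdorff_space_subtopology)
    show "compactin (subtopology X K) K" using K by (simp add: compactin_subtopology)
    show "seq_closedin (subtopology X K) (K \<inter> A)"
      unfolding seq_closedin_def
    proof (intro conjI allI impI)
      show "K \<inter> A \<subseteq> topspace (subtopology X K)" using KX by auto
      fix s :: "nat \<Rightarrow> 'a" and x
      assume h: "range s \<subseteq> K \<inter> A \<and> limitin (subtopology X K) s x sequentially"
      then have "x \<in> K" "limitin X s x sequentially" by (simp_all add: limitin_subtopology)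
      moreover have "x \<in> A"
        by (rule seq_closedinD[OF A _ \<open>limitin X s x sequentially\<close>]) (use h in blast)
      ultimately show "x \<in> K \<inter> A" by simp
    qed
  qed simp
  then show "closedin X A" using assms AX unfolding k_space_def by blast
qed

text \<open>
  Points are relative \<open>G\<^sub>\<delta>\<close>-sets in separable subspaces: if \<open>x \<noteq> \<zero>\<close> is in the closure of
  \<open>H\<close>, then some \<open>h \<in> H\<close> close to \<open>x\<close> satisfies \<open>\<ominus> x \<oplus> h \<in> D s\<close> and \<open>h \<notin> D s\<close>,
  which excludes \<open>x\<close> from the neighbourhood chosen for the pair \<open>(h, s)\<close>.
\<close>

lemma countable_pseudocharacter:
  assumes H: "countable H" "H \<subseteq> topspace X"
  shows "\<exists>\<A>. countable \<A> \<and> (\<forall>x\<in>X closure_of H. (\<forall>\<alpha>\<in>\<A>. x \<in> U \<alpha>) \<longrightarrow> x = \<zero>)"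
proof -
  \<comment> \<open>For \<open>y = \<zero>\<close> the difference
    \<open>\<ominus> y \<oplus> h\<close> is \<open>h\<close>, outside the closed set
    \<open>D s\<close>; this persists for \<open>y\<close> in some
    \<open>U \<alpha>\<close>.\<close>
  have "\<forall>p\<in>H \<times> UNIV. \<exists>\<alpha>. fst p \<notin> D (snd p) \<longrightarrow> (\<forall>y\<in>U \<alpha>. \<ominus> y \<oplus> fst p \<notin> D (snd p))"
  proof
    fix p :: "'a \<times> nat list" assume p: "p \<in> H \<times> UNIV"
    obtain h s where hs: "p = (h, s)" by (cases p)
    have h: "h \<in> topspace X" using p hs H(2) by auto
    have cont: "continuous_map X X (\<lambda>y. \<ominus> y \<oplus> h)"
      using h continuous_neg by (intro continuous_map_oplus) auto
    have "\<exists>\<alpha>. \<forall>y\<in>U \<alpha>. \<ominus> y \<oplus> h \<notin> D s" if hD: "h \<notin> D s"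
    proof -
      define W where "W = {y \<in> topspace X. \<ominus> y \<oplus> h \<in> topspace X - D s}"
      have "openin X W"
        unfolding W_def by (rule openin_continuous_map_preimage[OF cont]) (use D_closed in blast)
      moreover have "\<zero> \<in> W" using h hD zero_closed by (simp add: W_def)
      ultimately have "\<exists>\<alpha>. U \<alpha> \<subseteq> W" by (rule U_base)
      then obtain \<alpha> where "U \<alpha> \<subseteq> W" ..
      then show ?thesis by (intro exI[of _ \<alpha>]) (auto simp: W_def)
    qed
    then show "\<exists>\<alpha>. fst p \<notin> D (snd p) \<longrightarrow> (\<forall>y\<in>U \<alpha>. \<ominus> y \<oplus> fst p \<notin> D (snd p))"
      by (auto simp: hs)
  qed
  from bchoice[OF this] obtain a where
    a: "\<forall>p\<in>H \<times> UNIV. fst p \<notin> D (snd p) \<longrightarrow> (\<forall>y\<in>U (a p). \<ominus> y \<oplus> fst p \<notin> D (snd p))" ..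
  have "x = \<zero>" if x: "x \<in> X closure_of H" and xU: "\<forall>\<alpha>\<in>a ` (H \<times> UNIV). x \<in> U \<alpha>" for x
  proof (rule ccontr)
    assume "x \<noteq> \<zero>"
    have xX: "x \<in> topspace X" using x in_closure_of by metis
    have "openin X (topspace X - {x})"
      using Hausdorff xX by (intro openin_diff closedin_Hausdorff_singleton) auto
    moreover have "\<zero> \<in> topspace X - {x}" using \<open>x \<noteq> \<zero>\<close> zero_closed by simp
    ultimately have "\<exists>\<alpha>. U \<alpha> \<subseteq> topspace X - {x}" by (rule U_base)
    then obtain \<alpha> where \<alpha>: "U \<alpha> \<subseteq> topspace X - {x}" ..
    define O' where "O' = topspace X - U \<alpha>"
    have O': "openin X O'" "x \<in> O'" using U_closed \<alpha> xX by (auto simp: O'_def)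
    have meets: "\<exists>h. h \<in> H \<and> h \<in> W" if "openin X W" "x \<in> W" for W
      using x that in_closure_of[of x X H] by blast
    define H' where "H' = H \<inter> O'"
    have "H' \<noteq> {}" using meets[OF O'] by (auto simp: H'_def)
    define h where "h = from_nat_into H'"
    have h: "h n \<in> H'" for n using \<open>H' \<noteq> {}\<close> by (simp add: h_def from_nat_into)
    \<comment> \<open>The points of \<open>H\<close> outside \<open>U \<alpha>\<close> are
      enumerated, and the \<open>n\<close>-th one is tested against the prefix of length
      \<open>n\<close>. If all tests failed, some \<open>U \<gamma>\<close> would avoid every
      \<open>\<ominus> x \<oplus> h n\<close>, although \<open>x\<close> is in the closure of these
      points.\<close>
    have "\<exists>n. \<ominus> x \<oplus> h n \<in> D (pre \<alpha> n)"
    proof (rule ccontr)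
      assume "\<not> ?thesis"
      then obtain \<gamma> where \<gamma>: "\<forall>n. \<ominus> x \<oplus> h n \<notin> U \<gamma>"
        using avoid_D_sequence[of "\<lambda>n. \<ominus> x \<oplus> h n" \<alpha>] by auto
      obtain V where V: "openin X V" "\<zero> \<in> V" "V \<subseteq> U \<gamma>" using U_nbhd[of \<gamma>] by (elim exE conjE)
      define W where "W = {z \<in> topspace X. \<ominus> x \<oplus> z \<in> V} \<inter> O'"
      have "openin X W"
        unfolding W_def using O'(1) xX V(1) by (intro openin_Int openin_ltrans) (auto simp: closed_ops)
      moreover have "x \<in> W" using xX V(2) O'(2) by (simp add: W_def)
      ultimately have "\<exists>g. g \<in> H \<and> g \<in> W" by (rule meets)
      then obtain g where g: "g \<in> H" "g \<in> W" by (elim exE conjE)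
      then have "g \<in> H'" by (simp add: H'_def W_def)
      moreover have "countable H'" using H(1) by (simp add: H'_def)
      ultimately obtain n where "h n = g" using from_nat_into_surj[of H' g] by (auto simp: h_def)
      then show False using g(2) \<gamma> V(3) by (auto simp: W_def)
    qed
    then obtain n where n: "\<ominus> x \<oplus> h n \<in> D (pre \<alpha> n)" ..
    have hn: "h n \<in> H" "h n \<notin> U \<alpha>" using h[of n] by (auto simp: H'_def O'_def)
    then have "h n \<notin> D (pre \<alpha> n)" using D_pre_subset by blast
    moreover have "(h n, pre \<alpha> n) \<in> H \<times> UNIV" using hn(1) by simp
    ultimately have "\<forall>y\<in>U (a (h n, pre \<alpha> n)). \<ominus> y \<oplus> h n \<notin> D (pre \<alpha> n)"
      using a by fastforce
    moreover have "x \<in> U (a (h n, pre \<alpha> n))" using xU hn(1) by blast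
    ultimately show False using n by blast
  qed
  moreover have "countable (a ` (H \<times> UNIV))" using H(1) by simp
  ultimately show ?thesis by blast
qed

end

section \<open>Diagonal sequences and first countability\<close>

text \<open>Serves to sort a sequence drawn from a double array, first by rows and then by columns
  inside one row. If all fibres are finite, every index is followed by one with a larger
  value.\<close>

lemma infinite_fibre_or_strict_mono:
  fixes \<nu> :: "nat \<Rightarrow> nat"
  shows "(\<exists>n r. strict_mono (r :: nat \<Rightarrow> nat) \<and> (\<forall>k. \<nu> (r k) = n)) \<or>
    (\<exists>r. strict_mono (r :: nat \<Rightarrow> nat) \<and> strict_mono (\<nu> \<circ> r))"
proof (cases "\<exists>n. infinite {k. \<nu> k = n}")
  case True
  then obtain n where "infinite {k. \<nu> k = n}" ..
  from infinite_enumerate[OF this] show ?thesis by auto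
next
  case False
  have "\<exists>j. i < j \<and> \<nu> i < \<nu> j" for i
  proof (rule ccontr)
    assume "\<not> ?thesis"
    then have "\<nu> k \<le> \<nu> i" if "i < k" for k using that not_less by blast
    then have "{Suc i..} \<subseteq> (\<Union>n\<le>\<nu> i. {k. \<nu> k = n})"
      by (auto simp: Suc_le_eq)
    moreover have "finite (\<Union>n\<le>\<nu> i. {k. \<nu> k = n})" using False by simp
    ultimately show False using finite_subset infinite_Ici by blast
  qed
  then have "\<exists>r. (\<forall>n. True) \<and> (\<forall>n. r n < r (Suc n) \<and> \<nu> (r n) < \<nu> (r (Suc n)))"
    using dependent_nat_choice[of "\<lambda>_ _. True" "\<lambda>_ i j. i < j \<and> \<nu> i < \<nu> j"] by simp
  then show ?thesis by (auto simp: strict_mono_Suc_iff)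
qed

context omega_gyrogroup
begin

text \<open>Arhangel'skii's property \<open>\<alpha>\<^sub>4\<close> at the identity.\<close>

definition alpha4 :: bool where
  "alpha4 \<longleftrightarrow> (\<forall>z :: nat \<Rightarrow> nat \<Rightarrow> 'a. (\<forall>n. limitin X (z n) \<zero> sequentially) \<longrightarrow>
     (\<exists>\<nu> \<iota>. strict_mono (\<nu> :: nat \<Rightarrow> nat) \<and> limitin X (\<lambda>k. z (\<nu> k) (\<iota> k)) \<zero> sequentially))"

lemma limitin_unique:
  "\<lbrakk>limitin X s a sequentially; limitin X s b sequentially\<rbrakk> \<Longrightarrow> a = b"
  using limitin_Hausdorff_unique[of X s a sequentially b] Hausdorff by simp

lemma eventually_in_U:
  assumes "limitin X s \<zero> sequentially"
  shows "\<forall>\<^sub>F k in sequentially. s k \<in> U \<alpha>"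
proof -
  obtain V where V: "openin X V" "\<zero> \<in> V" "V \<subseteq> U \<alpha>" using U_nbhd[of \<alpha>] by (elim exE conjE)
  then have "\<forall>\<^sub>F k in sequentially. s k \<in> V" using assms by (simp add: limitin_def)
  then show ?thesis by (rule eventually_mono) (use V(3) in auto)
qed

lemma limitin_zeroI:
  assumes "\<And>\<alpha>. \<forall>\<^sub>F k in sequentially. s k \<in> U \<alpha>"
  shows "limitin X s \<zero> sequentially"
  unfolding limitin_def
proof (intro conjI allI impI zero_closed)
  fix W assume "openin X W \<and> \<zero> \<in> W"
  then have "\<exists>\<alpha>. U \<alpha> \<subseteq> W" by (intro U_base) auto
  then obtain \<alpha> where \<alpha>: "U \<alpha> \<subseteq> W" ..
  show "\<forall>\<^sub>F k in sequentially. s k \<in> W"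
    using assms[of \<alpha>] by (rule eventually_mono) (use \<alpha> in auto)
qed

text \<open>Non-compactness refutes sequential compactness by
  \<open>seq_compactin_imp_compactin\<close>. As \<open>S\<close> is closed, limits outside
  \<open>S\<close> are excluded too.\<close>

lemma exists_divergent_sequence:
  assumes "closedin X S" "\<not> compactin X S"
  shows "\<exists>d. range d \<subseteq> S \<and> (\<forall>r x. strict_mono (r :: nat \<Rightarrow> nat) \<longrightarrow> \<not> limitin X (d \<circ> r) x sequentially)"
proof -
  have "S \<subseteq> topspace X" using assms(1) closedin_subset by blast
  moreover have "\<not> seq_compactin X S" using assms(2) seq_compactin_imp_compactin by blast
  ultimately have "\<exists>d. range d \<subseteq> S \<and>
      \<not> (\<exists>r x. strict_mono (r :: nat \<Rightarrow> nat) \<and> x \<in> S \<and> limitin X (d \<circ> r) x sequentially)"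
    unfolding seq_compactin_def by simp
  then obtain d where d: "range d \<subseteq> S \<and>
      \<not> (\<exists>r x. strict_mono (r :: nat \<Rightarrow> nat) \<and> x \<in> S \<and> limitin X (d \<circ> r) x sequentially)" ..
  have "\<not> limitin X (d \<circ> r) x sequentially" if "strict_mono r" for r :: "nat \<Rightarrow> nat" and x
  proof
    assume lim: "limitin X (d \<circ> r) x sequentially"
    have "x \<in> S" by (rule closedin_limitin_sequentially[OF assms(1) _ lim]) (use d in auto)
    then show False using d lim that by auto
  qed
  then show ?thesis using d by auto
qed

text \<open>
  The set \<open>P = {y n i \<oplus> d n i}\<close> accumulates at \<open>\<zero>\<close> since the rows \<open>E n\<close> shrink to \<open>\<zero>\<close>.
  As \<open>(d n i)\<^sub>i\<close> has no convergent subsequence, a sequence in \<open>P\<close> with a limit outside \<open>P\<close>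
  has to run through infinitely many rows, and there the \<open>d\<close>-part tends to \<open>\<zero>\<close>.
\<close>

lemma noncompact_fan_imp_alpha4:
  fixes E :: "nat \<Rightarrow> 'a set"
  assumes seq: "sequential_space X"
    and E_closed: "\<And>n. closedin X (E n)"
    and E_dec: "\<And>m n. m \<le> n \<Longrightarrow> E n \<subseteq> E m"
    and E_small: "\<And>\<alpha>. \<exists>n. E n \<subseteq> U \<alpha>"
    and E_noncompact: "\<And>n. \<not> compactin X (E n)"
  shows alpha4
  unfolding alpha4_def
proof (intro allI impI)
  fix z :: "nat \<Rightarrow> nat \<Rightarrow> 'a"
  assume z: "\<forall>n. limitin X (z n) \<zero> sequentially"
  have "\<forall>n. \<exists>d. range d \<subseteq> E n \<and>
      (\<forall>r x. strict_mono (r :: nat \<Rightarrow> nat) \<longrightarrow> \<not> limitin X (d \<circ> r) x sequentially)"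
    using exists_divergent_sequence[OF E_closed E_noncompact] by simp
  from choice[OF this] obtain d where "\<forall>n. range (d n) \<subseteq> E n \<and>
      (\<forall>r x. strict_mono (r :: nat \<Rightarrow> nat) \<longrightarrow> \<not> limitin X (d n \<circ> r) x sequentially)" ..
  then have dE: "\<And>n i. d n i \<in> E n"
    and d_div: "\<And>n r x. strict_mono (r :: nat \<Rightarrow> nat) \<Longrightarrow> \<not> limitin X (d n \<circ> r) x sequentially"
    by auto
  have dX: "d n i \<in> topspace X" for n i using dE E_closed closedin_subset by blast
  define H where "H = topspace X \<inter> range (\<lambda>(n, i). z n i)"
  have "countable H" "H \<subseteq> topspace X" by (auto simp: H_def)
  from countable_pseudocharacter[OF this] obtain \<A> where
    \<A>: "countable \<A>" "\<forall>x\<in>X closure_of H. (\<forall>\<alpha>\<in>\<A>. x \<in> U \<alpha>) \<longrightarrow> x = \<zero>"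
    by (elim exE conjE)
  \<comment> \<open>One index is added so that the family is nonempty and can be enumerated.\<close>
  define a where "a = from_nat_into (insert (\<lambda>_. 0) \<A>)"
  have "range a = insert (\<lambda>_. 0) \<A>" unfolding a_def using \<A>(1) by (intro range_from_nat_into) auto
  then have \<A>_a: "\<A> \<subseteq> range a" by auto
  have "\<forall>n. \<exists>N. \<forall>i\<ge>N. z n i \<in> topspace X \<and> (\<forall>j\<le>n. z n i \<in> U (a j))"
  proof
    fix n
    have "\<forall>\<^sub>F i in sequentially. z n i \<in> topspace X"
      using z zero_closed by (simp add: limitin_def)
    moreover have "\<forall>\<^sub>F i in sequentially. \<forall>j\<in>{..n}. z n i \<in> U (a j)"
      using eventually_in_U z by (intro eventually_ball_finite) auto
    ultimately have "\<forall>\<^sub>F i in sequentially. z n i \<in> topspace X \<and> (\<forall>j\<le>n. z n i \<in> U (a j))"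
      by eventually_elim auto
    then show "\<exists>N. \<forall>i\<ge>N. z n i \<in> topspace X \<and> (\<forall>j\<le>n. z n i \<in> U (a j))"
      by (simp add: eventually_sequentially)
  qed
  from choice[OF this] obtain g where
    g: "\<forall>n. \<forall>i\<ge>g n. z n i \<in> topspace X \<and> (\<forall>j\<le>n. z n i \<in> U (a j))" ..
  \<comment> \<open>Row \<open>n\<close> is cut so as to lie in \<open>U (a 0)\<close>, ...,
    \<open>U (a n)\<close>. A limit of terms from ever later rows then lies in all
    \<open>U (a j)\<close>, and the choice of \<open>\<A>\<close> makes it
    \<open>\<zero>\<close>.\<close>
  define y where "y n i = z n (i + g n)" for n i
  have yX: "y n i \<in> topspace X" for n i using g by (simp add: y_def)
  have yU: "y n i \<in> U (a j)" if "j \<le> n" for n i j using g that by (simp add: y_def)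
  have yH: "y n i \<in> H" for n i using yX by (auto simp: H_def y_def)
  have y_lim: "limitin X (y n) \<zero> sequentially" for n
    unfolding y_def using z by (intro limitin_sequentially_offset) auto
  have d_eq: "d n i = \<ominus> (y n i) \<oplus> (y n i \<oplus> d n i)" for n i using yX dX by simp
  \<comment> \<open>The sums equal to \<open>\<zero>\<close> have to be left out of
    \<open>P\<close>, so that \<open>\<zero>\<close> is a missing accumulation point. Each row has
    finitely many of them, since otherwise \<open>d n i = \<ominus> (y n i)\<close> would converge
    along a subsequence.\<close>
  have "\<forall>n. \<exists>N. \<forall>i\<ge>N. y n i \<oplus> d n i \<noteq> \<zero>"
  proof (rule ccontr)
    assume "\<not> ?thesis"
    then obtain n where "\<forall>N. \<exists>i\<ge>N. y n i \<oplus> d n i = \<zero>" by auto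
    then have "infinite {i. y n i \<oplus> d n i = \<zero>}" by (auto simp: infinite_nat_iff_unbounded_le)
    from infinite_enumerate[OF this] obtain r :: "nat \<Rightarrow> nat"
      where r: "strict_mono r" "\<forall>k. r k \<in> {i. y n i \<oplus> d n i = \<zero>}" by (elim exE conjE)
    have "limitin X (\<lambda>k. \<ominus> (y n (r k))) (\<ominus> \<zero>) sequentially"
      using limitin_subsequence[OF r(1) y_lim] by (intro limitin_neg) (simp add: o_def)
    moreover have "\<ominus> (y n (r k)) = d n (r k)" for k
      using d_eq[of n "r k"] r(2) yX by (simp add: closed_ops)
    ultimately have "limitin X (d n \<circ> r) (\<ominus> \<zero>) sequentially" by (simp add: o_def)
    then show False using d_div r(1) by blast
  qed
  from choice[OF this] obtain f where f: "\<forall>n. \<forall>i\<ge>f n. y n i \<oplus> d n i \<noteq> \<zero>" ..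
  define P where "P = {y n i \<oplus> d n i | n i. f n \<le> i}"
  have PX: "P \<subseteq> topspace X" using yX dX by (auto simp: P_def oplus_closed)
  have zero_notin_P: "\<zero> \<notin> P" using f by (force simp: P_def)
  have "\<not> closedin X P"
  proof
    assume "closedin X P"
    then have op: "openin X (topspace X - P)" by blast
    have "continuous_map (prod_topology X X) X (\<lambda>p. fst p \<oplus> snd p)"
      by (intro continuous_map_gyro continuous_map_fst continuous_map_snd)
    moreover have "fst (\<zero>, \<zero>) \<oplus> snd (\<zero>, \<zero>) \<in> topspace X - P"
      using zero_notin_P zero_closed by simp
    ultimately have "\<exists>\<alpha>. \<forall>u\<in>U \<alpha>. \<forall>v\<in>U \<alpha>. fst (u, v) \<oplus> snd (u, v) \<in> topspace X - P"
      using op by (intro U_pair)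
    then obtain \<alpha> where \<alpha>: "\<forall>u\<in>U \<alpha>. \<forall>v\<in>U \<alpha>. fst (u, v) \<oplus> snd (u, v) \<in> topspace X - P" ..
    obtain n where n: "E n \<subseteq> U \<alpha>" using E_small[of \<alpha>] ..
    have "\<forall>\<^sub>F i in sequentially. y n i \<in> U \<alpha> \<and> f n \<le> i"
      using eventually_in_U[OF y_lim] eventually_ge_at_top[of "f n"] by (rule eventually_conj)
    then obtain i where i: "y n i \<in> U \<alpha>" "f n \<le> i"
      using eventually_happens[of _ sequentially] by auto
    have "d n i \<in> U \<alpha>" using n dE by blast
    then have "y n i \<oplus> d n i \<in> topspace X - P" using \<alpha> i(1) by auto
    moreover have "y n i \<oplus> d n i \<in> P" using i(2) by (auto simp: P_def)
    ultimately show False by simp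
  qed
  then have "\<not> seq_closedin X P" using seq sequential_space_iff by blast
  then obtain s q where s: "range s \<subseteq> P" "limitin X s q sequentially" "q \<notin> P"
    using PX unfolding seq_closedin_def by auto
  have "\<forall>k. \<exists>p. s k = y (fst p) (snd p) \<oplus> d (fst p) (snd p) \<and> f (fst p) \<le> snd p"
  proof
    fix k
    have "s k \<in> P" using s(1) by blast
    then obtain n i where "s k = y n i \<oplus> d n i" "f n \<le> i" by (auto simp: P_def)
    then show "\<exists>p. s k = y (fst p) (snd p) \<oplus> d (fst p) (snd p) \<and> f (fst p) \<le> snd p"
      by (intro exI[of _ "(n, i)"]) simp
  qed
  from choice[OF this] obtain p where
    p: "\<forall>k. s k = y (fst (p k)) (snd (p k)) \<oplus> d (fst (p k)) (snd (p k)) \<and> f (fst (p k)) \<le> snd (p k)" ..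
  define \<nu> \<iota> where "\<nu> k = fst (p k)" and "\<iota> k = snd (p k)" for k
  have s_eq: "s k = y (\<nu> k) (\<iota> k) \<oplus> d (\<nu> k) (\<iota> k)" and f_le: "f (\<nu> k) \<le> \<iota> k" for k
    using p by (auto simp: \<nu>_def \<iota>_def)
  have no_const: False if r: "strict_mono r" "\<forall>k. \<nu> (r k) = n" for n and r :: "nat \<Rightarrow> nat"
    using infinite_fibre_or_strict_mono[of "\<iota> \<circ> r"]
  proof (elim disjE exE conjE)
    fix i and r' :: "nat \<Rightarrow> nat" assume r': "strict_mono r'" "\<forall>k. (\<iota> \<circ> r) (r' k) = i"
    have "limitin X (s \<circ> (r \<circ> r')) q sequentially"
      using strict_mono_o[OF r(1) r'(1)] s(2) by (rule limitin_subsequence)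
    moreover have "s \<circ> (r \<circ> r') = (\<lambda>_. y n i \<oplus> d n i)"
      using r r' by (auto simp: fun_eq_iff s_eq)
    ultimately have "limitin X (\<lambda>_. y n i \<oplus> d n i) q sequentially" by simp
    moreover have "limitin X (\<lambda>_. y n i \<oplus> d n i) (y n i \<oplus> d n i) sequentially"
      using yX dX by (intro limitin_const' oplus_closed)
    ultimately have "q = y n i \<oplus> d n i" by (rule limitin_unique)
    moreover have "f n \<le> i" using f_le[of "r (r' 0)"] r r' by simp
    ultimately show False using s(3) by (auto simp: P_def)
  next
    fix r' :: "nat \<Rightarrow> nat" assume r': "strict_mono r'" "strict_mono ((\<iota> \<circ> r) \<circ> r')"
    define \<rho> where "\<rho> = (\<iota> \<circ> r) \<circ> r'"
    have "limitin X (s \<circ> (r \<circ> r')) q sequentially"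
      using strict_mono_o[OF r(1) r'(1)] s(2) by (rule limitin_subsequence)
    moreover have "limitin X (y n \<circ> \<rho>) \<zero> sequentially"
      using r'(2) y_lim unfolding \<rho>_def by (rule limitin_subsequence)
    ultimately have "limitin X (\<lambda>k. \<ominus> (y n (\<rho> k)) \<oplus> s (r (r' k))) (\<ominus> \<zero> \<oplus> q) sequentially"
      by (intro limitin_oplus limitin_neg) (simp_all add: o_def)
    \<comment> \<open>Inside one row the limit of \<open>y\<close> is known, and left cancellation
      recovers \<open>d\<close>. Across rows it is \<open>d\<close> that tends to
      \<open>\<zero>\<close>, and \<open>rsolve\<close> recovers \<open>y\<close>.\<close>
    moreover have "(\<lambda>k. \<ominus> (y n (\<rho> k)) \<oplus> s (r (r' k))) = d n \<circ> \<rho>"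
      using r(2) yX dX by (simp add: fun_eq_iff s_eq \<rho>_def)
    ultimately show False using d_div[of \<rho>] r'(2) by (simp add: \<rho>_def)
  qed
  obtain r :: "nat \<Rightarrow> nat" where r: "strict_mono r" "strict_mono (\<nu> \<circ> r)"
    using infinite_fibre_or_strict_mono[of \<nu>] no_const by auto
  have nu_ge: "k \<le> \<nu> (r k)" for k using seq_suble[OF r(2), of k] by simp
  have d_lim: "limitin X (\<lambda>k. d (\<nu> (r k)) (\<iota> (r k))) \<zero> sequentially"
  proof (rule limitin_zeroI)
    fix \<alpha>
    obtain n where n: "E n \<subseteq> U \<alpha>" using E_small[of \<alpha>] ..
    show "\<forall>\<^sub>F k in sequentially. d (\<nu> (r k)) (\<iota> (r k)) \<in> U \<alpha>"
      using eventually_ge_at_top[of n]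
    proof eventually_elim
      case (elim k)
      then have "E (\<nu> (r k)) \<subseteq> E n" using nu_ge[of k] by (intro E_dec) simp
      then show ?case using dE n by blast
    qed
  qed
  have q: "q \<in> topspace X" using s(2) limitin_topspace by metis
  have "limitin X (\<lambda>k. rsolve (s (r k)) (d (\<nu> (r k)) (\<iota> (r k)))) (rsolve q \<zero>) sequentially"
    using limitin_subsequence[OF r(1) s(2)] d_lim by (intro limitin_rsolve) (simp_all add: o_def)
  moreover have "rsolve (s (r k)) (d (\<nu> (r k)) (\<iota> (r k))) = y (\<nu> (r k)) (\<iota> (r k))" for k
    unfolding s_eq using yX dX by (intro rsolve_oplus)
  ultimately have y_q: "limitin X (\<lambda>k. y (\<nu> (r k)) (\<iota> (r k))) q sequentially"
    using rsolve_zero[OF q] by simp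
  have "q \<in> X closure_of H"
  proof (rule closedin_limitin_sequentially[OF closedin_closure_of _ y_q])
    show "y (\<nu> (r k)) (\<iota> (r k)) \<in> X closure_of H" for k
      using closure_of_subset[OF \<open>H \<subseteq> topspace X\<close>] yH by blast
  qed
  moreover have "q \<in> U (a j)" for j
  proof (rule limitin_closedin[OF y_q U_closed])
    show "\<forall>\<^sub>F k in sequentially. y (\<nu> (r k)) (\<iota> (r k)) \<in> U (a j)"
      using eventually_ge_at_top[of j]
    proof eventually_elim
      case (elim k)
      then show ?case using nu_ge[of k] by (intro yU) simp
    qed
  qed simp
  then have "\<forall>\<alpha>\<in>\<A>. q \<in> U \<alpha>" using \<A>_a by auto
  ultimately have "q = \<zero>" using \<A>(2) by blast
  then have "limitin X (\<lambda>k. z ((\<nu> \<circ> r) k) (\<iota> (r k) + g (\<nu> (r k)))) \<zero> sequentially"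
    using y_q by (simp add: y_def)
  then show "\<exists>\<nu> \<iota>. strict_mono (\<nu> :: nat \<Rightarrow> nat) \<and> limitin X (\<lambda>k. z (\<nu> k) (\<iota> k)) \<zero> sequentially"
    using r(2) by (intro exI[of _ "\<nu> \<circ> r"] exI[of _ "\<lambda>k. \<iota> (r k) + g (\<nu> (r k))"] conjI)
qed

text \<open>The set of limits of sequences in \<open>A\<close> is sequentially closed: rows
  converging to \<open>y n\<close> are translated to \<open>\<zero>\<close>, a diagonal is taken
  there, and adding \<open>y (\<nu> k)\<close> carries it to the limit of \<open>y\<close>.\<close>

lemma alpha4_imp_Frechet:
  assumes seq: "sequential_space X" and alpha4
    and A: "A \<subseteq> topspace X" "x \<in> X closure_of A"
  shows "\<exists>s. range s \<subseteq> A \<and> limitin X s x sequentially"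
proof -
  define A' where "A' = {x. \<exists>s. range s \<subseteq> A \<and> limitin X s x sequentially}"
  have A'X: "A' \<subseteq> topspace X" by (auto simp: A'_def limitin_def)
  have "seq_closedin X A'"
    unfolding seq_closedin_def
  proof (intro conjI allI impI A'X)
    fix y :: "nat \<Rightarrow> 'a" and q assume y: "range y \<subseteq> A' \<and> limitin X y q sequentially"
    have yX: "y n \<in> topspace X" for n using y A'X by blast
    have "\<forall>n. \<exists>s. range s \<subseteq> A \<and> limitin X s (y n) sequentially"
    proof
      fix n
      have "y n \<in> A'" using y by blast
      then show "\<exists>s. range s \<subseteq> A \<and> limitin X s (y n) sequentially" by (simp add: A'_def)
    qed
    from choice[OF this] obtain s where s: "\<forall>n. range (s n) \<subseteq> A \<and> limitin X (s n) (y n) sequentially" ..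
    have sX: "s n k \<in> topspace X" for n k using s A(1) by blast
    define z where "z n k = \<ominus> (y n) \<oplus> s n k" for n k
    have "limitin X (z n) (\<ominus> (y n) \<oplus> y n) sequentially" for n
      unfolding z_def using s yX by (intro limitin_oplus limitin_const' neg_closed) auto
    then have "\<forall>n. limitin X (z n) \<zero> sequentially" using yX by simp
    then have "\<exists>\<nu> \<iota>. strict_mono (\<nu> :: nat \<Rightarrow> nat) \<and> limitin X (\<lambda>k. z (\<nu> k) (\<iota> k)) \<zero> sequentially"
      using \<open>alpha4\<close> unfolding alpha4_def by simp
    then obtain \<nu> :: "nat \<Rightarrow> nat" and \<iota> where
      \<nu>: "strict_mono \<nu>" "limitin X (\<lambda>k. z (\<nu> k) (\<iota> k)) \<zero> sequentially" by (elim exE conjE)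
    have "limitin X (\<lambda>k. y (\<nu> k)) q sequentially"
      using limitin_subsequence[OF \<nu>(1), of X y q] y by (simp add: o_def)
    from limitin_oplus[OF this \<nu>(2)]
    have "limitin X (\<lambda>k. y (\<nu> k) \<oplus> z (\<nu> k) (\<iota> k)) (q \<oplus> \<zero>) sequentially" .
    moreover have "y (\<nu> k) \<oplus> z (\<nu> k) (\<iota> k) = s (\<nu> k) (\<iota> k)" for k
      unfolding z_def using yX sX by simp
    moreover have "q \<in> topspace X" using y limitin_topspace by metis
    ultimately have "limitin X (\<lambda>k. s (\<nu> k) (\<iota> k)) q sequentially" by simp
    moreover have "range (\<lambda>k. s (\<nu> k) (\<iota> k)) \<subseteq> A" using s by blast
    ultimately show "q \<in> A'" unfolding A'_def by blast
  qed
  then have "closedin X A'" using seq sequential_space_iff by blast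
  moreover have "A \<subseteq> A'"
  proof
    fix x assume x: "x \<in> A"
    then have "limitin X (\<lambda>_::nat. x) x sequentially" using A(1) by (intro limitin_const') auto
    then show "x \<in> A'" using x unfolding A'_def by (intro CollectI exI[of _ "\<lambda>_. x"]) auto
  qed
  ultimately have "X closure_of A \<subseteq> A'" by (intro closure_of_minimal)
  then show ?thesis using A(2) by (auto simp: A'_def)
qed

text \<open>Otherwise the complement of each \<open>D (pre \<alpha> n)\<close> contains a sequence
  tending to \<open>\<zero>\<close>, and a diagonal of these sequences would avoid some
  \<open>U \<gamma>\<close>.\<close>

lemma alpha4_imp_D_nbhd:
  assumes seq: "sequential_space X" and alpha4
  shows "\<exists>n V. openin X V \<and> \<zero> \<in> V \<and> V \<subseteq> D (pre \<alpha> n)"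
proof (rule ccontr)
  assume no: "\<not> ?thesis"
  have "\<forall>n. \<exists>s. range s \<subseteq> topspace X - D (pre \<alpha> n) \<and> limitin X s \<zero> sequentially"
  proof
    fix n
    have "\<zero> \<in> X closure_of (topspace X - D (pre \<alpha> n))"
      unfolding in_closure_of
    proof (intro conjI allI impI zero_closed)
      fix V assume V: "\<zero> \<in> V \<and> openin X V"
      then have "\<not> V \<subseteq> D (pre \<alpha> n)" using no by blast
      then obtain y where "y \<in> V" "y \<notin> D (pre \<alpha> n)" by blast
      moreover have "y \<in> topspace X" using \<open>y \<in> V\<close> V openin_subset by blast
      ultimately show "\<exists>y. y \<in> topspace X - D (pre \<alpha> n) \<and> y \<in> V" by blast
    qed
    then show "\<exists>s. range s \<subseteq> topspace X - D (pre \<alpha> n) \<and> limitin X s \<zero> sequentially"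
      using alpha4_imp_Frechet[OF assms] by simp
  qed
  from choice[OF this] obtain z where
    z: "\<forall>n. range (z n) \<subseteq> topspace X - D (pre \<alpha> n) \<and> limitin X (z n) \<zero> sequentially" ..
  then have "\<exists>\<nu> \<iota>. strict_mono (\<nu> :: nat \<Rightarrow> nat) \<and> limitin X (\<lambda>k. z (\<nu> k) (\<iota> k)) \<zero> sequentially"
    using \<open>alpha4\<close> unfolding alpha4_def by simp
  then obtain \<nu> :: "nat \<Rightarrow> nat" and \<iota> where
    \<nu>: "strict_mono \<nu>" "limitin X (\<lambda>k. z (\<nu> k) (\<iota> k)) \<zero> sequentially" by (elim exE conjE)
  \<comment> \<open>Row \<open>\<nu> k\<close> comes no earlier than row \<open>k\<close>, and
    \<open>D (pre \<alpha> n)\<close> grows with \<open>n\<close>.\<close>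
  have "z (\<nu> k) (\<iota> k) \<notin> D (pre \<alpha> k)" for k
  proof -
    have "z (\<nu> k) (\<iota> k) \<notin> D (pre \<alpha> (\<nu> k))" using z by blast
    then show ?thesis using D_pre_mono[OF seq_suble[OF \<nu>(1)], of \<alpha> k] by blast
  qed
  then have "\<exists>\<gamma>. \<forall>k. z (\<nu> k) (\<iota> k) \<notin> U \<gamma>" by (rule avoid_D_sequence)
  then obtain \<gamma> where "\<forall>k. z (\<nu> k) (\<iota> k) \<notin> U \<gamma>" ..
  then show False using eventually_in_U[OF \<nu>(2), of \<gamma>] by simp
qed

text \<open>Finite intersections \<open>B n\<close> of those \<open>D s\<close> that are
  neighbourhoods form a countable base at \<open>\<zero>\<close>; their left translates satisfy
  Frink's condition.\<close>

lemma D_nbhds_imp_metrizable: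
  assumes nbhd: "\<And>\<alpha>. \<exists>n V. openin X V \<and> \<zero> \<in> V \<and> V \<subseteq> D (pre \<alpha> n)"
  shows "metrizable_space X"
proof -
  define S where "S = {s. \<exists>V. openin X V \<and> \<zero> \<in> V \<and> V \<subseteq> D s}"
  have "S \<noteq> {}" using nbhd[of "\<lambda>_. 0"] by (auto simp: S_def)
  define b where "b = from_nat_into S"
  have b: "range b = S" unfolding b_def using \<open>S \<noteq> {}\<close> by (intro range_from_nat_into) auto
  define B where "B n = (\<Inter>j\<le>n. D (b j))" for n :: nat
  have B_dec: "B n \<subseteq> B m" if "m \<le> n" for m n using that by (auto simp: B_def)
  have B_base: "\<exists>n. B n \<subseteq> U \<alpha>" for \<alpha>
  proof -
    obtain n V where "openin X V \<and> \<zero> \<in> V \<and> V \<subseteq> D (pre \<alpha> n)" using nbhd[of \<alpha>] by (elim exE)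
    then have "pre \<alpha> n \<in> range b" unfolding b by (auto simp: S_def)
    then obtain j where "pre \<alpha> n = b j" by blast
    then have "B j \<subseteq> D (pre \<alpha> n)" by (auto simp: B_def)
    then show ?thesis using D_pre_subset by blast
  qed
  have B_nbhd: "\<exists>V. openin X V \<and> \<zero> \<in> V \<and> V \<subseteq> B n" for n
  proof -
    have "\<forall>j. \<exists>V. openin X V \<and> \<zero> \<in> V \<and> V \<subseteq> D (b j)"
    proof
      fix j
      have "b j \<in> S" using b by blast
      then show "\<exists>V. openin X V \<and> \<zero> \<in> V \<and> V \<subseteq> D (b j)" by (simp add: S_def)
    qed
    from choice[OF this] obtain V where V: "\<forall>j. openin X (V j) \<and> \<zero> \<in> V j \<and> V j \<subseteq> D (b j)" ..
    have "openin X (\<Inter>j\<in>{..n}. V j)" by (rule openin_INT2) (use V in auto)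
    then show ?thesis using V unfolding B_def by (intro exI[of _ "\<Inter>j\<le>n. V j"]) auto
  qed
  have BX: "B n \<subseteq> topspace X" for n
    using D_closed[of "b 0"] closedin_subset by (force simp: B_def)
  define C where "C n x = (\<lambda>u. x \<oplus> u) ` B n" for n x
  have in_C: "z \<in> C n x" if "x \<in> topspace X" "z \<in> topspace X" "\<ominus> x \<oplus> z \<in> B n" for n x z
    using that unfolding C_def by (intro image_eqI[of _ _ "\<ominus> x \<oplus> z"]) auto
  have C_nbhd: "\<exists>W. openin X W \<and> x \<in> W \<and> W \<subseteq> C n x" if x: "x \<in> topspace X" for n x
  proof -
    obtain V where V: "openin X V" "\<zero> \<in> V" "V \<subseteq> B n" using B_nbhd[of n] by (elim exE conjE)
    have "openin X {z \<in> topspace X. \<ominus> x \<oplus> z \<in> V}"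
      using neg_closed[OF x] V(1) by (rule openin_ltrans)
    then show ?thesis
      using V x by (intro exI[of _ "{z \<in> topspace X. \<ominus> x \<oplus> z \<in> V}"]) (auto intro!: in_C)
  qed
  show ?thesis
  proof (rule Frink_metrization[of X C])
    show "t1_space X" using Hausdorff by (rule Hausdorff_imp_t1_space)
    show "\<exists>V. openin X V \<and> x \<in> V \<and> V \<subseteq> C n x" if "x \<in> topspace X" for n x
      using that by (rule C_nbhd)
    show "\<exists>n. C n x \<subseteq> W" if W: "openin X W" "x \<in> W" for x W
    proof -
      obtain \<alpha> where \<alpha>: "\<forall>u\<in>U \<alpha>. x \<oplus> u \<in> W" using U_base_at[OF W] ..
      obtain n where "B n \<subseteq> U \<alpha>" using B_base[of \<alpha>] ..
      then show ?thesis using \<alpha> unfolding C_def by (intro exI[of _ n]) auto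
    qed
    show "C n x \<subseteq> C m x" if "m \<le> n" for m n x
      unfolding C_def using B_dec[OF that] by (rule image_mono)
    show "\<exists>m. \<forall>y\<in>topspace X. C m x \<inter> C m y \<noteq> {} \<longrightarrow> C m y \<subseteq> C n x" if x: "x \<in> topspace X" for n x
    proof -
      obtain W where W: "openin X W" "x \<in> W" "W \<subseteq> C n x" using C_nbhd[OF x, of n] by (elim exE conjE)
      \<comment> \<open>If \<open>x \<oplus> u = y \<oplus> v\<close>, the point
        \<open>y \<oplus> w\<close> of \<open>C m y\<close> equals \<open>t (u, v, w)\<close>, an
        expression without \<open>y\<close>. Continuity at the identity then gives an
        \<open>m\<close> that works for all \<open>y\<close>, though it depends on
        \<open>x\<close>.\<close>
      define t where "t = (\<lambda>p. rsolve (x \<oplus> fst p) (fst (snd p)) \<oplus> snd (snd p))"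
      have "continuous_map (prod_topology X (prod_topology X X)) X t"
        unfolding t_def using x
        by (intro continuous_map_gyro)
           (auto intro: continuous_map_fst continuous_map_snd
             continuous_map_compose[OF continuous_map_snd continuous_map_fst, unfolded o_def]
             continuous_map_compose[OF continuous_map_snd continuous_map_snd, unfolded o_def])
      moreover have "t (\<zero>, \<zero>, \<zero>) \<in> W" using x W(2) by (simp add: t_def rsolve_zero)
      ultimately have "\<exists>\<alpha>. \<forall>u\<in>U \<alpha>. \<forall>v\<in>U \<alpha>. \<forall>w\<in>U \<alpha>. t (u, v, w) \<in> W"
        using W(1) by (intro U_triple)
      then obtain \<alpha> where \<alpha>: "\<forall>u\<in>U \<alpha>. \<forall>v\<in>U \<alpha>. \<forall>w\<in>U \<alpha>. t (u, v, w) \<in> W" ..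
      obtain m where m: "B m \<subseteq> U \<alpha>" using B_base[of \<alpha>] ..
      have "C m y \<subseteq> C n x" if y: "y \<in> topspace X" and meet: "C m x \<inter> C m y \<noteq> {}" for y
      proof
        fix z assume "z \<in> C m y"
        then obtain w where w: "w \<in> B m" "z = y \<oplus> w" by (auto simp: C_def)
        obtain u v where uv: "u \<in> B m" "v \<in> B m" "x \<oplus> u = y \<oplus> v"
          using meet by (auto simp: C_def)
        have "rsolve (y \<oplus> v) v = y" using y uv(2) BX by (intro rsolve_oplus) auto
        then have "t (u, v, w) = z" by (simp add: t_def uv(3) w(2))
        moreover have "t (u, v, w) \<in> W" using \<alpha> m uv w by blast
        ultimately show "z \<in> C n x" using W(3) by blast
      qed
      then show ?thesis by blast
    qed
  qed
qed

section \<open>An open subgyrogroup generated by compact sets that absorb sequences\<close>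

lemma compactly_absorbed_imp_subgyrogroup:
  fixes C :: "nat \<Rightarrow> 'a set"
  assumes seq: "sequential_space X"
    and C: "\<And>j. compactin X (C j)"
    and absorb: "\<And>s. limitin X s \<zero> sequentially \<Longrightarrow> \<exists>j. \<forall>\<^sub>F k in sequentially. s k \<in> C j"
  shows "\<exists>H. subgyrogroup (topspace X) oplus gyr H \<and> openin X H \<and>
             submetrizable_space (subtopology X H) \<and> k_omega_space (subtopology X H)"
proof -
  \<comment> \<open>Each step adds one more \<open>C m\<close> and applies the operations once to
    the compact set reached so far. Compactness survives, and the union is closed under both
    operations.\<close>
  define Q where "Q = rec_nat {\<zero>}
    (\<lambda>m S. S \<union> C m \<union> (\<lambda>x. \<ominus> x) ` S \<union> (\<lambda>(x, y). x \<oplus> y) ` (S \<times> S))"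
  have Q_0: "Q 0 = {\<zero>}"
    and Q_Suc: "Q (Suc m) = Q m \<union> C m \<union> (\<lambda>x. \<ominus> x) ` Q m \<union> (\<lambda>(x, y). x \<oplus> y) ` (Q m \<times> Q m)" for m
    by (simp_all add: Q_def)
  have Q_compact: "compactin X (Q m)" for m
  proof (induction m)
    case 0
    then show ?case using zero_closed by (simp add: Q_0)
  next
    case (Suc m)
    have "compactin X ((\<lambda>x. \<ominus> x) ` Q m)" using Suc continuous_neg by (rule image_compactin)
    moreover have "compactin (prod_topology X X) (Q m \<times> Q m)" using Suc by (simp add: compactin_Times)
    then have "compactin X ((\<lambda>(x, y). x \<oplus> y) ` (Q m \<times> Q m))" using continuous_oplus by (rule image_compactin)
    ultimately show ?case unfolding Q_Suc using Suc C by (intro compactin_Un)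
  qed
  have Q_closed: "closedin X (Q m)" for m using Hausdorff Q_compact by (rule compactin_imp_closedin)
  have QX: "Q m \<subseteq> topspace X" for m using Q_compact by (rule compactin_subset_topspace)
  have Q_mono: "Q m \<subseteq> Q n" if "m \<le> n" for m n
    by (rule lift_Suc_mono_le[OF _ that]) (auto simp: Q_Suc)
  have Q_oplus: "x \<oplus> y \<in> Q (Suc (max m n))" if "x \<in> Q m" "y \<in> Q n" for x y m n
  proof -
    have "x \<in> Q (max m n)" "y \<in> Q (max m n)"
      using that Q_mono[of m "max m n"] Q_mono[of n "max m n"] by auto
    then have "(\<lambda>(x, y). x \<oplus> y) (x, y) \<in> (\<lambda>(x, y). x \<oplus> y) ` (Q (max m n) \<times> Q (max m n))"
      by (intro imageI) simp
    then show ?thesis by (simp add: Q_Suc)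
  qed
  have Q_absorb: "\<exists>j. \<forall>\<^sub>F k in sequentially. s k \<in> Q j" if lim: "limitin X s \<zero> sequentially" for s
  proof -
    obtain j where j: "\<forall>\<^sub>F k in sequentially. s k \<in> C j" using absorb[OF lim] ..
    have "\<forall>\<^sub>F k in sequentially. s k \<in> Q (Suc j)"
      using j by (rule eventually_mono) (simp add: Q_Suc)
    then show ?thesis ..
  qed
  define H where "H = (\<Union>m. Q m)"
  have QH: "Q m \<subseteq> H" for m by (auto simp: H_def)
  have HX: "H \<subseteq> topspace X" using QX by (auto simp: H_def)
  have H_oplus: "x \<oplus> y \<in> H" if xy: "x \<in> H" "y \<in> H" for x y
  proof -
    obtain m n where "x \<in> Q m" "y \<in> Q n" using xy by (auto simp: H_def)
    then show ?thesis using Q_oplus QH by blast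
  qed
  have H_neg: "\<ominus> x \<in> H" if x: "x \<in> H" for x
  proof -
    obtain m where "x \<in> Q m" using x by (auto simp: H_def)
    then have "\<ominus> x \<in> Q (Suc m)" by (simp add: Q_Suc)
    then show ?thesis using QH by blast
  qed
  have "\<zero> \<in> H" using QH[of 0] Q_0 by simp
  have diff_lim: "limitin X (\<lambda>k. \<ominus> x \<oplus> s k) \<zero> sequentially"
    if x: "limitin X s x sequentially" for s x
  proof -
    have xX: "x \<in> topspace X" using x limitin_topspace by metis
    have "limitin X (\<lambda>k. \<ominus> x \<oplus> s k) (\<ominus> x \<oplus> x) sequentially"
      using x xX by (intro limitin_oplus limitin_const' neg_closed)
    then show ?thesis using xX by simp
  qed
  \<comment> \<open>A sequence tending to \<open>x \<in> H\<close> has a term with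
    \<open>\<ominus> x \<oplus> s k\<close> in some \<open>Q j\<close>, and this term is in
    \<open>H\<close>.\<close>
  have "seq_closedin X (topspace X - H)"
    unfolding seq_closedin_def
  proof (intro conjI allI impI)
    fix s :: "nat \<Rightarrow> 'a" and x assume s: "range s \<subseteq> topspace X - H \<and> limitin X s x sequentially"
    have xX: "x \<in> topspace X" using s limitin_topspace by metis
    have "x \<notin> H"
    proof
      assume x: "x \<in> H"
      obtain j where "\<forall>\<^sub>F k in sequentially. \<ominus> x \<oplus> s k \<in> Q j"
        using Q_absorb[OF diff_lim[OF conjunct2[OF s]]] ..
      then obtain k where k: "\<ominus> x \<oplus> s k \<in> Q j" using eventually_happens[of _ sequentially] by auto
      have sk: "s k \<in> topspace X - H" using s by blast
      have "x \<oplus> (\<ominus> x \<oplus> s k) \<in> H" using x subsetD[OF QH k] by (rule H_oplus)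
      then show False using xX sk by simp
    qed
    then show "x \<in> topspace X - H" using xX by simp
  qed auto
  then have "closedin X (topspace X - H)" using seq sequential_space_iff by blast
  then have "openin X H" using HX by (simp add: openin_closedin_eq)
  moreover have "subgyrogroup (topspace X) oplus gyr H"
    using HX \<open>\<zero> \<in> H\<close> H_oplus H_neg by (rule subgyrogroup_closed)
  moreover have "submetrizable_space (subtopology X H)"
    unfolding H_def
  proof (rule submetrizable_subtopology)
    show "countable_network X (\<Union>m. Q m)"
      by (rule countable_network_Union) (rule compactin_countable_network[OF Q_compact])
    show "(\<Union>m. Q m) \<subseteq> topspace X" using QX by blast
  qed
  moreover have "k_omega_space (subtopology X H)"
    unfolding k_omega_space_def
  proof (intro exI[of _ Q] conjI allI impI)
    show "compactin (subtopology X H) (Q n)" for n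
      using Q_compact QH by (simp add: compactin_subtopology)
    show "topspace (subtopology X H) = (\<Union>n. Q n)"
      using HX by (simp add: topspace_subtopology Int_absorb1 flip: H_def)
    fix A assume A: "A \<subseteq> topspace (subtopology X H) \<and>
      (\<forall>n. closedin (subtopology (subtopology X H) (Q n)) (A \<inter> Q n))"
    have AH: "A \<subseteq> H" using A HX by (simp add: topspace_subtopology Int_absorb1)
    have A_Q: "closedin X (A \<inter> Q n)" for n
    proof -
      have "H \<inter> Q n = Q n" using QH[of n] by blast
      moreover have "closedin (subtopology X (H \<inter> Q n)) (A \<inter> Q n)"
        using A by (simp add: subtopology_subtopology)
      ultimately have "closedin (subtopology X (Q n)) (A \<inter> Q n)" by simp
      then show ?thesis using Q_closed closedin_trans_full by blast
    qed
    have "seq_closedin X A"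
      unfolding seq_closedin_def
    proof (intro conjI allI impI)
      show "A \<subseteq> topspace X" using AH HX by blast
      fix s :: "nat \<Rightarrow> 'a" and x assume s: "range s \<subseteq> A \<and> limitin X s x sequentially"
      have xX: "x \<in> topspace X" using s limitin_topspace by metis
      have sA: "s k \<in> A" for k using s by blast
      have sH: "s k \<in> H" for k using sA AH by blast
      have sX: "s k \<in> topspace X" for k using sH HX by blast
      \<comment> \<open>The limit \<open>x\<close> is not yet known to be in \<open>H\<close>. The
        differences in the reverse order tend to \<open>\<zero>\<close> as well and show this; only
        then can a tail of \<open>s\<close> be placed in a single \<open>Q\<close>.\<close>
      have "limitin X (\<lambda>k. \<ominus> (s k) \<oplus> x) (\<ominus> x \<oplus> x) sequentially"
        using s xX by (intro limitin_oplus limitin_neg limitin_const') auto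
      then have "limitin X (\<lambda>k. \<ominus> (s k) \<oplus> x) \<zero> sequentially" using xX by simp
      then obtain j where "\<forall>\<^sub>F k in sequentially. \<ominus> (s k) \<oplus> x \<in> Q j" using Q_absorb by meson
      then obtain k where k: "\<ominus> (s k) \<oplus> x \<in> Q j" using eventually_happens[of _ sequentially] by auto
      have "s k \<oplus> (\<ominus> (s k) \<oplus> x) \<in> H" using sH subsetD[OF QH k] by (rule H_oplus)
      then have "x \<in> H" using sX xX by simp
      then obtain m where m: "x \<in> Q m" by (auto simp: H_def)
      obtain i where i: "\<forall>\<^sub>F k in sequentially. \<ominus> x \<oplus> s k \<in> Q i"
        using Q_absorb[OF diff_lim[OF conjunct2[OF s]]] ..
      have "\<forall>\<^sub>F k in sequentially. s k \<in> A \<inter> Q (Suc (max m i))"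
        using i
      proof eventually_elim
        case (elim k)
        have "x \<oplus> (\<ominus> x \<oplus> s k) \<in> Q (Suc (max m i))" using m elim by (rule Q_oplus)
        then show ?case using xX sX sA by simp
      qed
      then have "x \<in> A \<inter> Q (Suc (max m i))"
        using s A_Q by (intro limitin_closedin[of X s x sequentially "A \<inter> Q (Suc (max m i))"]) auto
      then show "x \<in> A" by simp
    qed
    then have "closedin X A" using seq sequential_space_iff by blast
    then show "closedin (subtopology X H) A" using AH by (intro closedin_subset_topspace)
  qed
  ultimately show ?thesis by blast
qed

theorem sequential_imp_metrizable_or_k_omega:
  assumes seq: "sequential_space X"
  shows "metrizable_space X \<or>
    (\<exists>H. subgyrogroup (topspace X) oplus gyr H \<and> openin X H \<and>
         submetrizable_space (subtopology X H) \<and> k_omega_space (subtopology X H))"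
proof -
  \<comment> \<open>Lists of finite sequences make these finite intersections countable in number;
    \<open>topspace X\<close> is the value at the empty list.\<close>
  define E where "E l = \<Inter>(insert (topspace X) (D ` set l))" for l
  have E_closed: "closedin X (E l)" for l
    unfolding E_def using D_closed by (intro closedin_Inter) auto
  \<comment> \<open>Non-compact intersections are replaced by the empty set, which absorbs no
    sequence.\<close>
  define C where "C j = (if compactin X (E (from_nat j)) then E (from_nat j) else {})" for j
  have C: "compactin X (C j)" for j by (simp add: C_def)
  show ?thesis
  proof (cases "\<forall>s. limitin X s \<zero> sequentially \<longrightarrow> (\<exists>j. \<forall>\<^sub>F k in sequentially. s k \<in> C j)")
    case True
    show ?thesis
      by (rule disjI2, rule compactly_absorbed_imp_subgyrogroup[where C = C, OF seq C]) (use True in simp)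
  next
    case False
    then obtain s where s: "limitin X s \<zero> sequentially"
      and s_C: "\<forall>j. \<not> (\<forall>\<^sub>F k in sequentially. s k \<in> C j)" by blast
    have noncompact: "\<not> compactin X (E l)" if ev: "\<forall>\<^sub>F k in sequentially. s k \<in> E l" for l
    proof
      assume "compactin X (E l)"
      then have "C (to_nat l) = E l" by (simp add: C_def)
      then show False using s_C[THEN spec, of "to_nat l"] ev by simp
    qed
    \<comment> \<open>One sequence \<open>s\<close> absorbed by no \<open>C j\<close> rules out
      compactness of all \<open>F n\<close>, since each is a finite intersection of sets containing
      a tail of \<open>s\<close>. The \<open>F n\<close> shrink to \<open>\<zero>\<close> because
      \<open>B\<close> contains a prefix of every \<open>\<alpha>\<close>.\<close>
    define B where "B = {t. \<forall>\<^sub>F k in sequentially. s k \<in> D t}"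
    have pre_B: "\<exists>n. pre \<alpha> n \<in> B" for \<alpha>
      using eventually_in_D[OF s, of \<alpha>] by (simp add: B_def)
    then have "B \<noteq> {}" by blast
    define b where "b = from_nat_into B"
    have b: "range b = B" unfolding b_def using \<open>B \<noteq> {}\<close> by (intro range_from_nat_into) auto
    define F where "F n = E (map b [0..<Suc n])" for n
    have F_eq: "F n = topspace X \<inter> (\<Inter>j\<in>{..n}. D (b j))" for n
      by (auto simp: F_def E_def)
    have alpha4
    proof (rule noncompact_fan_imp_alpha4[OF seq, of F])
      show "closedin X (F n)" for n unfolding F_def by (rule E_closed)
      show "F n \<subseteq> F m" if "m \<le> n" for m n using that by (auto simp: F_eq)
      show "\<exists>n. F n \<subseteq> U \<alpha>" for \<alpha>
      proof -
        obtain n where "pre \<alpha> n \<in> range b" using pre_B[of \<alpha>] unfolding b ..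
        then obtain j where j: "pre \<alpha> n = b j" by blast
        have "F j \<subseteq> D (b j)" by (auto simp: F_eq)
        then show ?thesis using D_pre_subset[of \<alpha> n] unfolding j by (intro exI[of _ j]) (rule order_trans)
      qed
      show "\<not> compactin X (F n)" for n
        unfolding F_def
      proof (rule noncompact)
        have "\<forall>\<^sub>F k in sequentially. s k \<in> topspace X"
          using s zero_closed by (simp add: limitin_def)
        moreover have "\<forall>\<^sub>F k in sequentially. \<forall>j\<in>{..n}. s k \<in> D (b j)"
        proof (rule eventually_ball_finite)
          show "\<forall>j\<in>{..n}. \<forall>\<^sub>F k in sequentially. s k \<in> D (b j)"
          proof
            fix j
            have "b j \<in> B" using b by blast
            then show "\<forall>\<^sub>F k in sequentially. s k \<in> D (b j)" by (simp add: B_def)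
          qed
        qed simp
        ultimately have "\<forall>\<^sub>F k in sequentially. s k \<in> F n"
          by eventually_elim (simp add: F_eq)
        then show "\<forall>\<^sub>F k in sequentially. s k \<in> E (map b [0..<Suc n])" unfolding F_def .
      qed
    qed
    then have "metrizable_space X"
      by (intro D_nbhds_imp_metrizable alpha4_imp_D_nbhd[OF seq])
    then show ?thesis ..
  qed
qed

end

section \<open>From an open k_omega-subgyrogroup back to sequentiality\<close>

context topological_gyrogroup
begin

text \<open>The definition lets \<open>H\<close> have an identity \<open>e\<close> of its own;
  \<open>e \<oplus> e = e = e \<oplus> \<zero>\<close> and left cancellation identify it with
  \<open>\<zero>\<close>.\<close>

lemma zero_in_subgyrogroup:
  assumes "subgyrogroup (topspace X) oplus gyr H"
  shows "\<zero> \<in> H"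
proof -
  obtain e neg' gyr' where H: "gyrogroup H oplus e neg' gyr'" and HX: "H \<subseteq> topspace X"
    using assms unfolding subgyrogroup_def by blast
  have e: "e \<in> H" using H by (rule gyrogroup.zero_closed)
  have "e \<oplus> e = e" using gyrogroup.identity[OF H e] by simp
  moreover have "e \<in> topspace X" using e HX by blast
  ultimately have "e = \<zero>" using oplus_left_inj[of e e \<zero>] zero_closed by simp
  then show ?thesis using e by simp
qed

text \<open>Closedness is tested near each \<open>x\<close> on the open set
  \<open>x \<oplus> H\<close>. The k_omega property reduces it to the compact sets
  \<open>K n\<close>, where sequential closedness suffices by
  \<open>seq_closedin_compact_submetrizable\<close>.\<close>

lemma open_k_omega_imp_sequential_space:
  assumes "Hausdorff_space X" and H: "openin X H" "\<zero> \<in> H"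
    and sub: "submetrizable_space (subtopology X H)" and k\<omega>: "k_omega_space (subtopology X H)"
  shows "sequential_space X"
  unfolding sequential_space_iff
proof (intro allI impI)
  fix A assume A: "seq_closedin X A"
  have AX: "A \<subseteq> topspace X" using A by (simp add: seq_closedin_def)
  have HX: "H \<subseteq> topspace X" using H(1) openin_subset by blast
  define Z where "Z = subtopology X H"
  have Z: "topspace Z = H" "Hausdorff_space Z"
    using HX assms(1) by (auto simp: Z_def topspace_subtopology Hausdorff_space_subtopology)
  from k\<omega>[folded Z_def, unfolded k_omega_space_def] obtain K :: "nat \<Rightarrow> 'a set" where
    *: "(\<forall>n. compactin Z (K n)) \<and> topspace Z = (\<Union>n. K n) \<and>
      (\<forall>B. B \<subseteq> topspace Z \<and> (\<forall>n. closedin (subtopology Z (K n)) (B \<inter> K n)) \<longrightarrow> closedin Z B)" ..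
  then have K: "\<And>n. compactin Z (K n)"
    "\<And>B. \<lbrakk>B \<subseteq> topspace Z; \<forall>n. closedin (subtopology Z (K n)) (B \<inter> K n)\<rbrakk> \<Longrightarrow> closedin Z B"
    by simp_all
  have "\<exists>V. openin X V \<and> x \<in> V \<and> V \<subseteq> topspace X - A" if x: "x \<in> topspace X - A" for x
  proof -
    have xX: "x \<in> topspace X" using x by simp
    \<comment> \<open>The trace of \<open>A\<close> on \<open>x \<oplus> H\<close>, pulled back to
      \<open>H\<close>; that \<open>x\<close> is not in \<open>A\<close> means
      \<open>\<zero> \<notin> B\<close>.\<close>
    define B where "B = {h \<in> H. x \<oplus> h \<in> A}"
    have B_seq: "seq_closedin Z B"
      unfolding seq_closedin_def
    proof (intro conjI allI impI)
      show "B \<subseteq> topspace Z" by (auto simp: Z B_def)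
      fix s :: "nat \<Rightarrow> 'a" and h assume s: "range s \<subseteq> B \<and> limitin Z s h sequentially"
      then have lim: "limitin X s h sequentially" "h \<in> H" by (simp_all add: Z_def limitin_subtopology)
      have lim': "limitin X (\<lambda>k. x \<oplus> s k) (x \<oplus> h) sequentially"
        using lim xX by (intro limitin_oplus limitin_const')
      have "x \<oplus> s k \<in> A" for k
      proof -
        have "s k \<in> B" using s by blast
        then show ?thesis by (simp add: B_def)
      qed
      then have "x \<oplus> h \<in> A" using lim' by (rule seq_closedinD[OF A])
      then show "h \<in> B" using lim by (simp add: B_def)
    qed
    have "closedin Z B"
    proof (rule K(2))
      show "B \<subseteq> topspace Z" by (auto simp: Z B_def)
      show "\<forall>n. closedin (subtopology Z (K n)) (B \<inter> K n)"
      proof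
        fix n
        have "closedin Z (K n)" using Z(2) K(1) by (rule compactin_imp_closedin)
        then have "seq_closedin Z (B \<inter> K n)"
          by (rule seq_closedin_Int[OF B_seq closedin_imp_seq_closedin])
        then have "closedin Z (B \<inter> K n)"
          using sub Z(2) K(1) by (intro seq_closedin_compact_submetrizable[of Z "K n"]) (auto simp: Z_def)
        then show "closedin (subtopology Z (K n)) (B \<inter> K n)"
          by (rule closedin_subset_topspace) simp
      qed
    qed
    then have "openin Z (topspace Z - B)" by blast
    then have "openin X (H - B)"
      unfolding Z(1) unfolding Z_def using openin_trans_full H(1) by blast
    with neg_closed[OF xX] have "openin X {y \<in> topspace X. \<ominus> x \<oplus> y \<in> H - B}" by (rule openin_ltrans)
    moreover have "x \<in> {y \<in> topspace X. \<ominus> x \<oplus> y \<in> H - B}"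
      using x H(2) by (simp add: B_def)
    moreover have "{y \<in> topspace X. \<ominus> x \<oplus> y \<in> H - B} \<subseteq> topspace X - A"
      using xX by (auto simp: B_def)
    ultimately show ?thesis by blast
  qed
  then have "openin X (topspace X - A)" by (subst openin_subopen) blast
  then show "closedin X A" using AX by (simp add: closedin_def)
qed

end

theorem corollary3p3:
  fixes X :: "'a topology"
    and oplus :: "'a \<Rightarrow> 'a \<Rightarrow> 'a"
    and zero :: 'a
    and neg :: "'a \<Rightarrow> 'a"
    and gyr :: "'a \<Rightarrow> 'a \<Rightarrow> 'a \<Rightarrow> 'a"
  assumes "topological_gyrogroup X oplus zero neg gyr"
    and "Hausdorff_space X"
    and "has_omega_omega_base X"
  shows "(k_space X \<longleftrightarrow> sequential_space X) \<and>
         (sequential_space X \<longleftrightarrow>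
            metrizable_space X \<or>
            (\<exists>H. subgyrogroup (topspace X) oplus gyr H \<and> openin X H \<and>
                 submetrizable_space (subtopology X H) \<and> k_omega_space (subtopology X H)))"
proof -
  interpret topological_gyrogroup X oplus zero neg gyr by (rule assms(1))
  obtain U where "omega_gyrogroup X oplus zero neg gyr U"
    using assms(2,3) by (rule ex_omega_gyrogroup)
  then interpret omega_gyrogroup X oplus zero neg gyr U .
  have "k_space X \<longleftrightarrow> sequential_space X"
    using k_space_imp_sequential_space sequential_imp_k_space by (rule iffI)
  moreover have "sequential_space X"
    if "\<exists>H. subgyrogroup (topspace X) oplus gyr H \<and> openin X H \<and>
         submetrizable_space (subtopology X H) \<and> k_omega_space (subtopology X H)"
    using that open_k_omega_imp_sequential_space[OF assms(2)] zero_in_subgyrogroup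
    by (elim exE conjE) simp
  ultimately show ?thesis
    using sequential_imp_metrizable_or_k_omega metrizable_imp_sequential_space by (intro conjI iffI) auto
qed

end
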